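(* Let $\mathcal{A}$ be a ground class of normed algebras with $(BA)\subset\mathcal{A}$, and for a map $R$ on $\mathcal{A}$ define $R'$ on $(NA)$ by $R'(A)=A\cap R(\overline{A})$. If $R$ is a topological radical (TR) on $\mathcal{A}$, then $R'$ is an over topological radical (OTR) on $(NA)$. If $R$ is a hereditary topological radical (HTR) on $\mathcal{A}$, then $R'$ is an HTR on $(NA)$.
   Context: All algebras are complex and associative; "ideal" means two-sided ideal. $(NA)$ and $(BA)$ are the classes of all normed and of all Banach algebras; $\overline{A}$ is the completion of a normed algebra $A$. A topological isomorphism is an algebra isomorphism continuous together with its inverse. For a closed ideal $I$ of $A$, $q_I:A\to A/I$ is the quotient map. A class $\mathcal{A}\subset(NA)$ is a ground class if it contains all normed algebras topologically isomorphic to closed ideals of algebras in $\mathcal{A}$ and all normed algebras topologically isomorphic to quotients of algebras in $\mathcal{A}$ by closed ideals. Let $\mathcal{A}$ be a ground class and let $R$ be a map assigning to each $A\in\mathcal{A}$ a closed ideal $R(A)$ of $A$. Consider the conditions: (1°) $R(R(A))=R(A)$ for all $A\in\mathcal{A}$; (2°) $R(A/R(A))=0$ for all $A\in\mathcal{A}$; (3°) $f(R(A))=R(B)$ for every topological isomorphism $f:A\to B$ with $A,B\in\mathcal{A}$; (4°) $q_I(R(A))\subset R(A/I)$ for every closed ideal $I$ of $A\in\mathcal{A}$; (5°) if an ideal $I$ of $A\in\mathcal{A}$ belongs to $\mathcal{A}$, then $R(I)$ is an ideal of $A$ and $R(I)\subset I\cap R(A)$; (6°) $R(I)=I\cap R(A)$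 for every ideal $I\in\mathcal{A}$ of $A\in\mathcal{A}$. $R$ is a TR on $\mathcal{A}$ if (1°)–(5°) hold, an HTR if it is a TR and (6°) holds, and an OTR if (2°), (3°), (4°), (5°) hold. *)

theory Defs
  imports "HOL-Analysis.Analysis" "HOL-Library.Infinite_Typeclass"
begin

text \<open>
  HOL has no proper classes, so a class of algebras is a set of algebras whose carriers are subsets
  of a type \<^typ>\<open>'a\<close> playing the role of a universe.  The universe must contain a
  completion of every normed algebra it contains, for which it suffices that it absorbs its own
  sequences.  This costs no generality: by the instance below, every type \<^typ>\<open>'u\<close> embeds
  (by constant functions) into such a universe, for example \<^typ>\<open>nat \<Rightarrow> 'u\<close>.
\<close>

class sequence_closed =
  assumes ex_inj_seq: "\<exists>e :: (nat \<Rightarrow> 'a) \<Rightarrow> 'a. inj e"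

lemma ex_bij_times_infinite:
  includes cardinal_syntax
  shows "\<exists>g :: nat \<times> 'k::infinite \<Rightarrow> 'k. bij g"
proof -
  have "|UNIV :: nat set| \<le>o |UNIV :: 'k set|"
    using infinite_UNIV infinite_iff_card_of_nat by blast
  then have "|(UNIV :: 'k set) \<times> (UNIV :: nat set)| =o |UNIV :: 'k set|"
    using infinite_UNIV by (intro card_of_Times_infinite[THEN conjunct1]) auto
  then have "|(UNIV :: nat set) \<times> (UNIV :: 'k set)| =o |UNIV :: 'k set|"
    using card_of_Times_commute ordIso_transitive by blast
  then show ?thesis
    unfolding UNIV_Times_UNIV using card_of_ordIso by blast
qed

lemma ex_inj_seq_fun: "\<exists>e :: (nat \<Rightarrow> 'k::infinite \<Rightarrow> 'b) \<Rightarrow> 'k \<Rightarrow> 'b. inj e"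
proof -
  obtain g :: "nat \<times> 'k \<Rightarrow> 'k" where g: "bij g"
    using ex_bij_times_infinite by blast
  define e :: "(nat \<Rightarrow> 'k \<Rightarrow> 'b) \<Rightarrow> 'k \<Rightarrow> 'b"
    where "e s = (\<lambda>k. case inv g k of (i, j) \<Rightarrow> s i j)" for s
  have "s i j = e s (g (i, j))" for s i j
    using g by (simp add: e_def bij_is_inj)
  then have "inj e"
    by (intro injI ext) metis
  then show ?thesis by blast
qed

instance "fun" :: (infinite, type) sequence_closed
  by standard (rule ex_inj_seq_fun)

record 'a nalg =
  acarrier :: "'a set"
  aadd :: "'a \<Rightarrow> 'a \<Rightarrow> 'a"
  amult :: "'a \<Rightarrow> 'a \<Rightarrow> 'a"
  azero :: 'a
  ascale :: "complex \<Rightarrow> 'a \<Rightarrow> 'a"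
  anorm :: "'a \<Rightarrow> real"

text \<open>Complex, associative, not necessarily unital or nonzero.\<close>

locale normed_algebra =
  fixes A :: "'a nalg"
  assumes zero_closed: "azero A \<in> acarrier A"
    and add_closed: "\<lbrakk>x \<in> acarrier A; y \<in> acarrier A\<rbrakk> \<Longrightarrow> aadd A x y \<in> acarrier A"
    and mult_closed: "\<lbrakk>x \<in> acarrier A; y \<in> acarrier A\<rbrakk> \<Longrightarrow> amult A x y \<in> acarrier A"
    and scale_closed: "x \<in> acarrier A \<Longrightarrow> ascale A c x \<in> acarrier A"
    and add_assoc: "\<lbrakk>x \<in> acarrier A; y \<in> acarrier A; z \<in> acarrier A\<rbrakk>
      \<Longrightarrow> aadd A (aadd A x y) z = aadd A x (aadd A y z)"
    and add_commute: "\<lbrakk>x \<in> acarrier A; y \<in> acarrier A\<rbrakk> \<Longrightarrow> aadd A x y = aadd A y x"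
    and add_zero: "x \<in> acarrier A \<Longrightarrow> aadd A x (azero A) = x"
    and add_neg: "x \<in> acarrier A \<Longrightarrow> aadd A x (ascale A (-1) x) = azero A"
    and scale_add_right: "\<lbrakk>x \<in> acarrier A; y \<in> acarrier A\<rbrakk>
      \<Longrightarrow> ascale A c (aadd A x y) = aadd A (ascale A c x) (ascale A c y)"
    and scale_add_left: "x \<in> acarrier A
      \<Longrightarrow> ascale A (c + d) x = aadd A (ascale A c x) (ascale A d x)"
    and scale_scale: "x \<in> acarrier A \<Longrightarrow> ascale A c (ascale A d x) = ascale A (c * d) x"
    and scale_one: "x \<in> acarrier A \<Longrightarrow> ascale A 1 x = x"
    and mult_assoc: "\<lbrakk>x \<in> acarrier A; y \<in> acarrier A; z \<in> acarrier A\<rbrakk>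
      \<Longrightarrow> amult A (amult A x y) z = amult A x (amult A y z)"
    and mult_add_left: "\<lbrakk>x \<in> acarrier A; y \<in> acarrier A; z \<in> acarrier A\<rbrakk>
      \<Longrightarrow> amult A (aadd A x y) z = aadd A (amult A x z) (amult A y z)"
    and mult_add_right: "\<lbrakk>x \<in> acarrier A; y \<in> acarrier A; z \<in> acarrier A\<rbrakk>
      \<Longrightarrow> amult A x (aadd A y z) = aadd A (amult A x y) (amult A x z)"
    and mult_scale_left: "\<lbrakk>x \<in> acarrier A; y \<in> acarrier A\<rbrakk>
      \<Longrightarrow> amult A (ascale A c x) y = ascale A c (amult A x y)"
    and mult_scale_right: "\<lbrakk>x \<in> acarrier A; y \<in> acarrier A\<rbrakk>
      \<Longrightarrow> amult A x (ascale A c y) = ascale A c (amult A x y)"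
    and norm_eq_zero: "x \<in> acarrier A \<Longrightarrow> anorm A x = 0 \<longleftrightarrow> x = azero A"
    and norm_triangle: "\<lbrakk>x \<in> acarrier A; y \<in> acarrier A\<rbrakk>
      \<Longrightarrow> anorm A (aadd A x y) \<le> anorm A x + anorm A y"
    and norm_scale: "x \<in> acarrier A \<Longrightarrow> anorm A (ascale A c x) = cmod c * anorm A x"
    and norm_mult: "\<lbrakk>x \<in> acarrier A; y \<in> acarrier A\<rbrakk>
      \<Longrightarrow> anorm A (amult A x y) \<le> anorm A x * anorm A y"

definition adiff :: "'a nalg \<Rightarrow> 'a \<Rightarrow> 'a \<Rightarrow> 'a"
  where "adiff A x y = aadd A x (ascale A (-1) y)"

text \<open>The value 0 off the carrier is needed because \<^locale>\<open>Metric_space\<close> demands a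
  nonnegative symmetric function on the whole type.\<close>

definition adist :: "'a nalg \<Rightarrow> 'a \<Rightarrow> 'a \<Rightarrow> real"
  where "adist A x y = (if x \<in> acarrier A \<and> y \<in> acarrier A then anorm A (adiff A x y) else 0)"

lemma (in normed_algebra) Metric_space_adist: "Metric_space (acarrier A) (adist A)"
proof -
  have diff_closed: "adiff A x y \<in> acarrier A" if "x \<in> acarrier A" "y \<in> acarrier A" for x y
    using that by (simp add: adiff_def add_closed scale_closed)
  have neg_neg: "ascale A (-1) (ascale A (-1) x) = x" if "x \<in> acarrier A" for x
    using that by (simp add: scale_scale scale_one)
  have cancel: "aadd A (aadd A x (ascale A (-1) y)) y = x"
    if "x \<in> acarrier A" "y \<in> acarrier A" for x y
    using that by (metis add_assoc add_commute add_neg add_zero scale_closed)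
  have diff_swap: "adiff A y x = ascale A (-1) (adiff A x y)"
    if "x \<in> acarrier A" "y \<in> acarrier A" for x y
    using that by (simp add: adiff_def scale_add_right scale_closed neg_neg add_commute)
  have norm_swap: "anorm A (adiff A y x) = anorm A (adiff A x y)"
    if "x \<in> acarrier A" "y \<in> acarrier A" for x y
    using that by (simp add: diff_swap[of x y] norm_scale diff_closed)
  have norm_nonneg: "0 \<le> anorm A x" if "x \<in> acarrier A" for x
    using that norm_triangle[of x "ascale A (-1) x"] norm_eq_zero[OF zero_closed]
    by (simp add: add_neg scale_closed norm_scale)
  have diff_zero: "adiff A x y = azero A \<longleftrightarrow> x = y" if "x \<in> acarrier A" "y \<in> acarrier A" for x y
    using that cancel[of x y]
    by (metis adiff_def add_commute add_neg add_zero zero_closed)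
  have diff_split: "adiff A x z = aadd A (adiff A x y) (adiff A y z)"
    if "x \<in> acarrier A" "y \<in> acarrier A" "z \<in> acarrier A" for x y z
    using that cancel[of x y] unfolding adiff_def
    by (metis add_assoc add_closed scale_closed)
  show ?thesis
  proof
    show "0 \<le> adist A x y" for x y
      by (simp add: adist_def norm_nonneg diff_closed)
    show "adist A x y = adist A y x" for x y
      by (simp add: adist_def norm_swap)
    show "adist A x y = 0 \<longleftrightarrow> x = y" if "x \<in> acarrier A" "y \<in> acarrier A" for x y
      using that by (simp add: adist_def norm_eq_zero diff_closed diff_zero)
    show "adist A x z \<le> adist A x y + adist A y z"
      if "x \<in> acarrier A" "y \<in> acarrier A" "z \<in> acarrier A" for x y z
      using that by (simp add: adist_def diff_split[of x y z] norm_triangle diff_closed)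
  qed
qed

definition atopology :: "'a nalg \<Rightarrow> 'a topology"
  where "atopology A = Metric_space.mtopology (acarrier A) (adist A)"

definition NA :: "'a nalg set"
  where "NA = {A. normed_algebra A}"

definition BA :: "'a nalg set"
  where "BA = {A. normed_algebra A \<and> Metric_space.mcomplete (acarrier A) (adist A)}"

definition alg_hom :: "'a nalg \<Rightarrow> 'a nalg \<Rightarrow> ('a \<Rightarrow> 'a) \<Rightarrow> bool"
  where "alg_hom A B f \<longleftrightarrow>
    f \<in> acarrier A \<rightarrow> acarrier B \<and>
    (\<forall>x\<in>acarrier A. \<forall>y\<in>acarrier A. f (aadd A x y) = aadd B (f x) (f y)) \<and>
    (\<forall>x\<in>acarrier A. \<forall>y\<in>acarrier A. f (amult A x y) = amult B (f x) (f y)) \<and>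
    (\<forall>c. \<forall>x\<in>acarrier A. f (ascale A c x) = ascale B c (f x))"

definition topological_iso :: "'a nalg \<Rightarrow> 'a nalg \<Rightarrow> ('a \<Rightarrow> 'a) \<Rightarrow> bool"
  where "topological_iso A B f \<longleftrightarrow>
    alg_hom A B f \<and> bij_betw f (acarrier A) (acarrier B) \<and>
    continuous_map (atopology A) (atopology B) f \<and>
    continuous_map (atopology B) (atopology A) (inv_into (acarrier A) f)"

definition alg_ideal :: "'a nalg \<Rightarrow> 'a set \<Rightarrow> bool"
  where "alg_ideal A I \<longleftrightarrow>
    I \<subseteq> acarrier A \<and> azero A \<in> I \<and>
    (\<forall>x\<in>I. \<forall>y\<in>I. aadd A x y \<in> I) \<and>
    (\<forall>c. \<forall>x\<in>I. ascale A c x \<in> I) \<and>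
    (\<forall>a\<in>acarrier A. \<forall>x\<in>I. amult A a x \<in> I \<and> amult A x a \<in> I)"

definition closed_ideal :: "'a nalg \<Rightarrow> 'a set \<Rightarrow> bool"
  where "closed_ideal A I \<longleftrightarrow> alg_ideal A I \<and> closedin (atopology A) I"

text \<open>An ideal regarded as a normed algebra under the inherited structure.\<close>

definition sub_alg :: "'a nalg \<Rightarrow> 'a set \<Rightarrow> 'a nalg"
  where "sub_alg A I = A\<lparr>acarrier := I\<rparr>"

text \<open>To keep quotients inside the universe, every coset \<open>x + I\<close> is replaced by a chosen
  representative \<open>quot_map A I x\<close>; the choice depends on the coset only.\<close>

definition quot_map :: "'a nalg \<Rightarrow> 'a set \<Rightarrow> 'a \<Rightarrow> 'a"
  where "quot_map A I x = (SOME y. y \<in> (\<lambda>i. aadd A x i) ` I)"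

definition quot_alg :: "'a nalg \<Rightarrow> 'a set \<Rightarrow> 'a nalg"
  where "quot_alg A I =
    \<lparr>acarrier = quot_map A I ` acarrier A,
     aadd = (\<lambda>x y. quot_map A I (aadd A x y)),
     amult = (\<lambda>x y. quot_map A I (amult A x y)),
     azero = quot_map A I (azero A),
     ascale = (\<lambda>c x. quot_map A I (ascale A c x)),
     anorm = (\<lambda>x. INF i\<in>I. anorm A (aadd A x i))\<rparr>"

definition is_completion :: "'a nalg \<Rightarrow> 'a nalg \<Rightarrow> ('a \<Rightarrow> 'a) \<Rightarrow> bool"
  where "is_completion A B \<iota> \<longleftrightarrow>
    B \<in> BA \<and> alg_hom A B \<iota> \<and>
    (\<forall>x\<in>acarrier A. anorm B (\<iota> x) = anorm A x) \<and>
    atopology B closure_of (\<iota> ` acarrier A) = acarrier B"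

text \<open>The completion is unique up to isometric isomorphism; one is chosen, together with the
  embedding \<open>completion_map A\<close> that identifies \<open>A\<close> with a dense subalgebra of it.\<close>

definition completion_pair :: "'a nalg \<Rightarrow> 'a nalg \<times> ('a \<Rightarrow> 'a)"
  where "completion_pair A = (SOME p. is_completion A (fst p) (snd p))"

definition completion :: "'a nalg \<Rightarrow> 'a nalg"
  where "completion A = fst (completion_pair A)"

definition completion_map :: "'a nalg \<Rightarrow> 'a \<Rightarrow> 'a"
  where "completion_map A = snd (completion_pair A)"

definition ground_class :: "'a nalg set \<Rightarrow> bool"
  where "ground_class \<A> \<longleftrightarrow>
    \<A> \<subseteq> NA \<and>
    (\<forall>A\<in>\<A>. \<forall>I. closed_ideal A I \<longrightarrow>
      (\<forall>B\<in>NA. (\<exists>f. topological_iso B (sub_alg A I) f) \<longrightarrow> B \<in> \<A>) \<and>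
      (\<forall>B\<in>NA. (\<exists>f. topological_iso B (quot_alg A I) f) \<longrightarrow> B \<in> \<A>))"

definition closed_ideal_map :: "'a nalg set \<Rightarrow> ('a nalg \<Rightarrow> 'a set) \<Rightarrow> bool"
  where "closed_ideal_map \<A> R \<longleftrightarrow> (\<forall>A\<in>\<A>. closed_ideal A (R A))"

definition idempotent_rad :: "'a nalg set \<Rightarrow> ('a nalg \<Rightarrow> 'a set) \<Rightarrow> bool"
  where "idempotent_rad \<A> R \<longleftrightarrow> (\<forall>A\<in>\<A>. R (sub_alg A (R A)) = R A)"

definition zero_on_quot_rad :: "'a nalg set \<Rightarrow> ('a nalg \<Rightarrow> 'a set) \<Rightarrow> bool"
  where "zero_on_quot_rad \<A> R \<longleftrightarrow>
    (\<forall>A\<in>\<A>. R (quot_alg A (R A)) = {azero (quot_alg A (R A))})"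

definition iso_invariant_rad :: "'a nalg set \<Rightarrow> ('a nalg \<Rightarrow> 'a set) \<Rightarrow> bool"
  where "iso_invariant_rad \<A> R \<longleftrightarrow>
    (\<forall>A\<in>\<A>. \<forall>B\<in>\<A>. \<forall>f. topological_iso A B f \<longrightarrow> f ` R A = R B)"

definition quot_map_rad :: "'a nalg set \<Rightarrow> ('a nalg \<Rightarrow> 'a set) \<Rightarrow> bool"
  where "quot_map_rad \<A> R \<longleftrightarrow>
    (\<forall>A\<in>\<A>. \<forall>I. closed_ideal A I \<longrightarrow> quot_map A I ` R A \<subseteq> R (quot_alg A I))"

definition ideal_rad :: "'a nalg set \<Rightarrow> ('a nalg \<Rightarrow> 'a set) \<Rightarrow> bool"
  where "ideal_rad \<A> R \<longleftrightarrow>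
    (\<forall>A\<in>\<A>. \<forall>I. alg_ideal A I \<and> sub_alg A I \<in> \<A> \<longrightarrow>
      alg_ideal A (R (sub_alg A I)) \<and> R (sub_alg A I) \<subseteq> I \<inter> R A)"

definition hereditary_rad :: "'a nalg set \<Rightarrow> ('a nalg \<Rightarrow> 'a set) \<Rightarrow> bool"
  where "hereditary_rad \<A> R \<longleftrightarrow>
    (\<forall>A\<in>\<A>. \<forall>I. alg_ideal A I \<and> sub_alg A I \<in> \<A> \<longrightarrow> R (sub_alg A I) = I \<inter> R A)"

definition OTR :: "'a nalg set \<Rightarrow> ('a nalg \<Rightarrow> 'a set) \<Rightarrow> bool"
  where "OTR \<A> R \<longleftrightarrow>
    closed_ideal_map \<A> R \<and> zero_on_quot_rad \<A> R \<and> iso_invariant_rad \<A> R \<and>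
    quot_map_rad \<A> R \<and> ideal_rad \<A> R"

definition TR :: "'a nalg set \<Rightarrow> ('a nalg \<Rightarrow> 'a set) \<Rightarrow> bool"
  where "TR \<A> R \<longleftrightarrow>
    closed_ideal_map \<A> R \<and> idempotent_rad \<A> R \<and> zero_on_quot_rad \<A> R \<and>
    iso_invariant_rad \<A> R \<and> quot_map_rad \<A> R \<and> ideal_rad \<A> R"

definition HTR :: "'a nalg set \<Rightarrow> ('a nalg \<Rightarrow> 'a set) \<Rightarrow> bool"
  where "HTR \<A> R \<longleftrightarrow> TR \<A> R \<and> hereditary_rad \<A> R"

text \<open>\<open>A \<inter> R (completion A)\<close>, as a subset of \<open>A\<close>.\<close>

definition completion_rad :: "('a nalg \<Rightarrow> 'a set) \<Rightarrow> 'a nalg \<Rightarrow> 'a set"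
  where "completion_rad R A = {x \<in> acarrier A. completion_map A x \<in> R (completion A)}"

end

theory Submission
  imports Defs
begin

text \<open>
  Write \<open>C\<close> for the completion of a normed algebra \<open>A\<close>, and \<open>R' A = A \<inter> R C\<close>.  Completion turns each
  construction that occurs in the conditions on \<open>R'\<close> into the same construction for Banach algebras,
  where the condition on \<open>R\<close> applies:
  \<^item> the closure in \<open>C\<close> of an ideal \<open>I\<close> of \<open>A\<close> is a closed ideal of \<open>C\<close> and a completion of \<open>I\<close>;
  \<^item> if \<open>I\<close> is closed and \<open>K\<close> is its closure in \<open>C\<close>, then \<open>C / K\<close> is a completion of \<open>A / I\<close>;
  \<^item> a topological isomorphism \<open>A \<rightarrow> B\<close>, followed by the embedding of \<open>B\<close> into its completion, makes the
    completion of \<open>B\<close> a completion of \<open>A\<close>.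

  Here a completion is any Banach algebra containing the given algebra, up to a topological isomorphism,
  as a dense subalgebra.  Two such Banach algebras are topologically isomorphic over \<open>A\<close>
  (\<open>dense_embedding_unique\<close>), and \<open>R\<close> commutes with topological isomorphisms, so \<open>R' A\<close> can be computed
  in any of them (\<open>completion_rad_eq\<close>).

  With this, isomorphism invariance, compatibility with quotient maps, and the conditions on ideals,
  heredity among them, follow for \<open>R'\<close> from those for \<open>R\<close> by intersecting with \<open>A\<close>.  Idempotence of
  \<open>R'\<close> is heredity for the ideal \<open>R' A\<close> of \<open>A\<close>.  That \<open>R'\<close> vanishes on \<open>A / R' A\<close> needs an argument:
  the closure \<open>K\<close> of \<open>R' A\<close> in \<open>C\<close> can be smaller than \<open>R C\<close>, so that \<open>R (C / R C) = 0\<close> does not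
  speak of the completion \<open>C / K\<close> of \<open>A / R' A\<close>.  But the map \<open>C / K \<rightarrow> C / R C\<close>, a quotient map up to
  isomorphism, sends \<open>R (C / K)\<close> into \<open>R (C / R C) = 0\<close>, hence \<open>R (C / K)\<close> is contained in
  \<open>R C / K\<close> (\<open>quot_map_mem_rad_imp\<close>), and an element \<open>x\<close> of \<open>A\<close> whose coset lies in \<open>R' (A / R' A)\<close>
  belongs to \<open>R C\<close>.
\<close>

section \<open>Arithmetic in seminormed algebras\<close>

text \<open>
  Completions and quotients are both obtained by identifying elements at distance 0: Cauchy sequences
  under the limit of their norms, and elements of an algebra under their distance from an ideal.  Before
  the identification the norm may vanish on nonzero elements, while all other axioms hold already.
\<close>

locale seminormed_algebra =
  fixes A :: "'a nalg"
  assumes zero_closed: "azero A \<in> acarrier A"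
    and add_closed: "\<lbrakk>x \<in> acarrier A; y \<in> acarrier A\<rbrakk> \<Longrightarrow> aadd A x y \<in> acarrier A"
    and mult_closed: "\<lbrakk>x \<in> acarrier A; y \<in> acarrier A\<rbrakk> \<Longrightarrow> amult A x y \<in> acarrier A"
    and scale_closed: "x \<in> acarrier A \<Longrightarrow> ascale A c x \<in> acarrier A"
    and add_assoc: "\<lbrakk>x \<in> acarrier A; y \<in> acarrier A; z \<in> acarrier A\<rbrakk>
      \<Longrightarrow> aadd A (aadd A x y) z = aadd A x (aadd A y z)"
    and add_commute: "\<lbrakk>x \<in> acarrier A; y \<in> acarrier A\<rbrakk> \<Longrightarrow> aadd A x y = aadd A y x"
    and add_zero: "x \<in> acarrier A \<Longrightarrow> aadd A x (azero A) = x"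
    and add_neg: "x \<in> acarrier A \<Longrightarrow> aadd A x (ascale A (-1) x) = azero A"
    and scale_add_right: "\<lbrakk>x \<in> acarrier A; y \<in> acarrier A\<rbrakk>
      \<Longrightarrow> ascale A c (aadd A x y) = aadd A (ascale A c x) (ascale A c y)"
    and scale_add_left: "x \<in> acarrier A
      \<Longrightarrow> ascale A (c + d) x = aadd A (ascale A c x) (ascale A d x)"
    and scale_scale: "x \<in> acarrier A \<Longrightarrow> ascale A c (ascale A d x) = ascale A (c * d) x"
    and scale_one: "x \<in> acarrier A \<Longrightarrow> ascale A 1 x = x"
    and mult_assoc: "\<lbrakk>x \<in> acarrier A; y \<in> acarrier A; z \<in> acarrier A\<rbrakk>
      \<Longrightarrow> amult A (amult A x y) z = amult A x (amult A y z)"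
    and mult_add_left: "\<lbrakk>x \<in> acarrier A; y \<in> acarrier A; z \<in> acarrier A\<rbrakk>
      \<Longrightarrow> amult A (aadd A x y) z = aadd A (amult A x z) (amult A y z)"
    and mult_add_right: "\<lbrakk>x \<in> acarrier A; y \<in> acarrier A; z \<in> acarrier A\<rbrakk>
      \<Longrightarrow> amult A x (aadd A y z) = aadd A (amult A x y) (amult A x z)"
    and mult_scale_left: "\<lbrakk>x \<in> acarrier A; y \<in> acarrier A\<rbrakk>
      \<Longrightarrow> amult A (ascale A c x) y = ascale A c (amult A x y)"
    and mult_scale_right: "\<lbrakk>x \<in> acarrier A; y \<in> acarrier A\<rbrakk>
      \<Longrightarrow> amult A x (ascale A c y) = ascale A c (amult A x y)"
    and norm_triangle: "\<lbrakk>x \<in> acarrier A; y \<in> acarrier A\<rbrakk>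
      \<Longrightarrow> anorm A (aadd A x y) \<le> anorm A x + anorm A y"
    and norm_scale: "x \<in> acarrier A \<Longrightarrow> anorm A (ascale A c x) = cmod c * anorm A x"
    and norm_mult: "\<lbrakk>x \<in> acarrier A; y \<in> acarrier A\<rbrakk>
      \<Longrightarrow> anorm A (amult A x y) \<le> anorm A x * anorm A y"
begin

lemma diff_closed: "\<lbrakk>x \<in> acarrier A; y \<in> acarrier A\<rbrakk> \<Longrightarrow> adiff A x y \<in> acarrier A"
  by (simp add: adiff_def add_closed scale_closed)

lemmas closed = zero_closed add_closed mult_closed scale_closed diff_closed

lemma zero_add: "x \<in> acarrier A \<Longrightarrow> aadd A (azero A) x = x"
  using add_commute add_zero zero_closed by simp

lemma add_left_commute:
  "\<lbrakk>x \<in> acarrier A; y \<in> acarrier A; z \<in> acarrier A\<rbrakk>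
    \<Longrightarrow> aadd A x (aadd A y z) = aadd A y (aadd A x z)"
  by (metis add_assoc add_commute)

lemmas add_ac = add_assoc add_commute add_left_commute

lemma add_diff_cancel:
  "\<lbrakk>x \<in> acarrier A; y \<in> acarrier A\<rbrakk> \<Longrightarrow> aadd A y (adiff A x y) = x"
  by (simp add: adiff_def add_left_commute closed add_neg add_zero)

lemma diff_self: "x \<in> acarrier A \<Longrightarrow> adiff A x x = azero A"
  by (simp add: adiff_def add_neg)

lemma diff_eq_zero_iff:
  "\<lbrakk>x \<in> acarrier A; y \<in> acarrier A\<rbrakk> \<Longrightarrow> adiff A x y = azero A \<longleftrightarrow> x = y"
  by (metis add_diff_cancel add_zero diff_self)

lemma scale_zero_left: "x \<in> acarrier A \<Longrightarrow> ascale A 0 x = azero A"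
  using scale_add_left[of x 1 "-1"] by (simp add: scale_one add_neg)

lemma scale_zero_right: "ascale A c (azero A) = azero A"
  by (metis mult_zero_right scale_scale scale_zero_left zero_closed)

lemma diff_zero: "x \<in> acarrier A \<Longrightarrow> adiff A x (azero A) = x"
  by (simp add: adiff_def scale_zero_right add_zero)

lemma norm_zero: "anorm A (azero A) = 0"
  using norm_scale[OF zero_closed, of 0] by (simp add: scale_zero_right)

lemma norm_neg: "x \<in> acarrier A \<Longrightarrow> anorm A (ascale A (-1) x) = anorm A x"
  by (simp add: norm_scale)

lemma norm_nonneg: "x \<in> acarrier A \<Longrightarrow> 0 \<le> anorm A x"
  using norm_triangle[of x "ascale A (-1) x"]
  by (simp add: add_neg scale_closed norm_neg norm_zero)

lemma scale_diff:
  "\<lbrakk>x \<in> acarrier A; y \<in> acarrier A\<rbrakk>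
    \<Longrightarrow> adiff A (ascale A c x) (ascale A c y) = ascale A c (adiff A x y)"
  by (simp add: adiff_def scale_add_right scale_scale closed)

lemma diff_swap:
  "\<lbrakk>x \<in> acarrier A; y \<in> acarrier A\<rbrakk> \<Longrightarrow> ascale A (-1) (adiff A x y) = adiff A y x"
  by (simp add: adiff_def scale_add_right scale_scale scale_one closed add_commute)

lemma add_diff_add:
  "\<lbrakk>x \<in> acarrier A; y \<in> acarrier A; x' \<in> acarrier A; y' \<in> acarrier A\<rbrakk>
    \<Longrightarrow> adiff A (aadd A x x') (aadd A y y') = aadd A (adiff A x y) (adiff A x' y')"
  by (simp add: adiff_def scale_add_right closed add_ac)

lemma diff_trans:
  "\<lbrakk>x \<in> acarrier A; y \<in> acarrier A; z \<in> acarrier A\<rbrakk>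
    \<Longrightarrow> aadd A (adiff A x y) (adiff A y z) = adiff A x z"
  by (metis add_diff_add add_diff_cancel add_commute diff_closed diff_self add_zero zero_add zero_closed)

lemma mult_diff_mult:
  assumes "x \<in> acarrier A" "y \<in> acarrier A" "x' \<in> acarrier A" "y' \<in> acarrier A"
  shows "adiff A (amult A x x') (amult A y y') =
    aadd A (amult A x (adiff A x' y')) (amult A (adiff A x y) y')"
proof -
  have "adiff A (amult A x x') (amult A x y') = amult A x (adiff A x' y')"
    using assms by (simp add: adiff_def mult_add_right mult_scale_right closed)
  moreover have "adiff A (amult A x y') (amult A y y') = amult A (adiff A x y) y'"
    using assms by (simp add: adiff_def mult_add_left mult_scale_left closed)
  ultimately show ?thesis
    using assms diff_trans[of "amult A x x'" "amult A x y'" "amult A y y'"] by (simp add: closed)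
qed

lemma dist_commute:
  "\<lbrakk>x \<in> acarrier A; y \<in> acarrier A\<rbrakk> \<Longrightarrow> anorm A (adiff A x y) = anorm A (adiff A y x)"
  by (metis diff_closed diff_swap norm_neg)

lemma dist_triangle:
  "\<lbrakk>x \<in> acarrier A; y \<in> acarrier A; z \<in> acarrier A\<rbrakk>
    \<Longrightarrow> anorm A (adiff A x z) \<le> anorm A (adiff A x y) + anorm A (adiff A y z)"
  by (metis diff_closed diff_trans norm_triangle)

lemma dist_add:
  "\<lbrakk>x \<in> acarrier A; y \<in> acarrier A; x' \<in> acarrier A; y' \<in> acarrier A\<rbrakk>
    \<Longrightarrow> anorm A (adiff A (aadd A x x') (aadd A y y'))
      \<le> anorm A (adiff A x y) + anorm A (adiff A x' y')"
  by (simp add: add_diff_add norm_triangle closed)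

lemma dist_scale:
  "\<lbrakk>x \<in> acarrier A; y \<in> acarrier A\<rbrakk>
    \<Longrightarrow> anorm A (adiff A (ascale A c x) (ascale A c y)) = cmod c * anorm A (adiff A x y)"
  by (simp add: scale_diff norm_scale closed)

lemma dist_mult:
  assumes "x \<in> acarrier A" "y \<in> acarrier A" "x' \<in> acarrier A" "y' \<in> acarrier A"
  shows "anorm A (adiff A (amult A x x') (amult A y y'))
      \<le> anorm A x * anorm A (adiff A x' y') + anorm A (adiff A x y) * anorm A y'"
  unfolding mult_diff_mult[OF assms]
  using assms by (intro order_trans[OF norm_triangle] add_mono norm_mult closed)

lemma norm_dist:
  assumes "x \<in> acarrier A" "y \<in> acarrier A"
  shows "\<bar>anorm A x - anorm A y\<bar> \<le> anorm A (adiff A x y)"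
proof -
  have le: "anorm A x \<le> anorm A y + anorm A (adiff A x y)"
    if "x \<in> acarrier A" "y \<in> acarrier A" for x y
    using that by (metis add_diff_cancel diff_closed norm_triangle)
  show ?thesis
    using le[of x y] le[of y x] assms dist_commute[of x y] by linarith
qed

end

sublocale normed_algebra \<subseteq> seminormed_algebra
  by (unfold_locales;
    fact zero_closed add_closed mult_closed scale_closed add_assoc add_commute add_zero add_neg
      scale_add_right scale_add_left scale_scale scale_one mult_assoc mult_add_left mult_add_right
      mult_scale_left mult_scale_right norm_triangle norm_scale norm_mult)

lemma normed_algebraI:
  assumes "seminormed_algebra B"
    and "\<And>x. \<lbrakk>x \<in> acarrier B; anorm B x = 0\<rbrakk> \<Longrightarrow> x = azero B"
  shows "normed_algebra B"
proof -
  interpret seminormed_algebra B by fact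
  show ?thesis
    by (unfold_locales;
      (fact zero_closed add_closed mult_closed scale_closed add_assoc add_commute add_zero add_neg
        scale_add_right scale_add_left scale_scale scale_one mult_assoc mult_add_left mult_add_right
        mult_scale_left mult_scale_right norm_triangle norm_scale norm_mult
      | use assms(2) norm_zero in blast))
qed

lemma normed_algebra_surjective_image:
  fixes D :: "'b nalg" and B :: "'a nalg"
  assumes "seminormed_algebra D"
    and carrier: "acarrier B = \<phi> ` acarrier D"
    and zero: "azero B = \<phi> (azero D)"
    and add: "\<And>x y. \<lbrakk>x \<in> acarrier D; y \<in> acarrier D\<rbrakk> \<Longrightarrow> aadd B (\<phi> x) (\<phi> y) = \<phi> (aadd D x y)"
    and mult: "\<And>x y. \<lbrakk>x \<in> acarrier D; y \<in> acarrier D\<rbrakk> \<Longrightarrow> amult B (\<phi> x) (\<phi> y) = \<phi> (amult D x y)"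
    and scale: "\<And>c x. x \<in> acarrier D \<Longrightarrow> ascale B c (\<phi> x) = \<phi> (ascale D c x)"
    and norm: "\<And>x. x \<in> acarrier D \<Longrightarrow> anorm B (\<phi> x) = anorm D x"
    and null: "\<And>x. \<lbrakk>x \<in> acarrier D; anorm D x = 0\<rbrakk> \<Longrightarrow> \<phi> x = \<phi> (azero D)"
  shows "normed_algebra B"
proof (rule normed_algebraI)
  interpret D: seminormed_algebra D by fact
  show "seminormed_algebra B"
  proof
    show "aadd B x y = aadd B y x" if "x \<in> acarrier B" "y \<in> acarrier B" for x y
      using that D.add_commute by (auto simp: carrier add)
  qed (auto simp: carrier zero add mult scale norm D.closed D.add_assoc D.mult_assoc D.add_zero
      D.add_neg D.scale_add_right D.scale_add_left D.scale_scale D.scale_one D.mult_add_left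
      D.mult_add_right D.mult_scale_left D.mult_scale_right D.norm_triangle D.norm_scale
      D.norm_mult)
  show "x = azero B" if "x \<in> acarrier B" "anorm B x = 0" for x
    using that by (auto simp: carrier zero norm null)
qed

section \<open>Sequences and topology\<close>

definition tends_to :: "'a nalg \<Rightarrow> (nat \<Rightarrow> 'a) \<Rightarrow> 'a \<Rightarrow> bool"
  where "tends_to A s x \<longleftrightarrow> range s \<subseteq> acarrier A \<and> x \<in> acarrier A \<and>
    (\<lambda>n. anorm A (adiff A (s n) x)) \<longlonglongrightarrow> 0"

definition is_cauchy :: "'a nalg \<Rightarrow> (nat \<Rightarrow> 'a) \<Rightarrow> bool"
  where "is_cauchy A s \<longleftrightarrow> range s \<subseteq> acarrier A \<and>
    (\<forall>e>0. \<exists>N. \<forall>m\<ge>N. \<forall>n\<ge>N. anorm A (adiff A (s m) (s n)) < e)"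

lemma tends_toD:
  assumes "tends_to A s x"
  shows "s n \<in> acarrier A" "x \<in> acarrier A" "(\<lambda>n. anorm A (adiff A (s n) x)) \<longlonglongrightarrow> 0"
  using assms by (auto simp: tends_to_def)

lemma is_cauchy_closed: "is_cauchy A s \<Longrightarrow> s n \<in> acarrier A"
  by (auto simp: is_cauchy_def)

context seminormed_algebra
begin

lemma tends_toI:
  assumes "\<And>n. s n \<in> acarrier A" "x \<in> acarrier A"
    and "\<And>n. anorm A (adiff A (s n) x) \<le> f n" "f \<longlonglongrightarrow> 0"
  shows "tends_to A s x"
  unfolding tends_to_def
proof (intro conjI)
  show "(\<lambda>n. anorm A (adiff A (s n) x)) \<longlonglongrightarrow> 0"
    by (rule Lim_null_comparison[OF _ assms(4)])
      (use assms in \<open>simp add: norm_nonneg closed\<close>)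
qed (use assms in auto)

lemma tends_to_const: "x \<in> acarrier A \<Longrightarrow> tends_to A (\<lambda>n. x) x"
  by (rule tends_toI[where f = "\<lambda>n. 0"]) (auto simp: diff_self norm_zero)

lemma tends_to_add:
  assumes "tends_to A s x" "tends_to A t y"
  shows "tends_to A (\<lambda>n. aadd A (s n) (t n)) (aadd A x y)"
proof (rule tends_toI)
  show "(\<lambda>n. anorm A (adiff A (s n) x) + anorm A (adiff A (t n) y)) \<longlonglongrightarrow> 0"
    using tendsto_add[OF tends_toD(3)[OF assms(1)] tends_toD(3)[OF assms(2)]] by simp
qed (use assms in \<open>auto simp: tends_toD closed dist_add\<close>)

lemma tends_to_scale:
  assumes "tends_to A s x"
  shows "tends_to A (\<lambda>n. ascale A c (s n)) (ascale A c x)"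
proof (rule tends_toI)
  show "(\<lambda>n. cmod c * anorm A (adiff A (s n) x)) \<longlonglongrightarrow> 0"
    using tendsto_mult_left[OF tends_toD(3)[OF assms(1)]] by simp
qed (use assms in \<open>auto simp: tends_toD closed dist_scale\<close>)

lemma tends_to_norm:
  assumes "tends_to A s x"
  shows "(\<lambda>n. anorm A (s n)) \<longlonglongrightarrow> anorm A x"
proof -
  have "(\<lambda>n. anorm A (s n) - anorm A x) \<longlonglongrightarrow> 0"
    by (rule Lim_null_comparison[OF _ tends_toD(3)[OF assms]])
      (use assms in \<open>simp add: norm_dist tends_toD\<close>)
  then show ?thesis
    using LIM_zero_iff by blast
qed

lemma tends_to_mult:
  assumes "tends_to A s x" "tends_to A t y"
  shows "tends_to A (\<lambda>n. amult A (s n) (t n)) (amult A x y)"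
proof (rule tends_toI)
  show "(\<lambda>n. anorm A (s n) * anorm A (adiff A (t n) y) + anorm A (adiff A (s n) x) * anorm A y)
      \<longlonglongrightarrow> 0"
    using tendsto_add[OF tendsto_mult[OF tends_to_norm[OF assms(1)] tends_toD(3)[OF assms(2)]]
        tendsto_mult_right[OF tends_toD(3)[OF assms(1)], of "anorm A y"]] by simp
qed (use assms in \<open>auto simp: tends_toD closed dist_mult\<close>)

lemma tends_to_diff:
  assumes "tends_to A s x" "tends_to A t y"
  shows "tends_to A (\<lambda>n. adiff A (s n) (t n)) (adiff A x y)"
  unfolding adiff_def by (intro tends_to_add tends_to_scale assms)

lemma tends_to_perturb:
  assumes "tends_to A s x" "\<And>n. t n \<in> acarrier A"
    and "\<And>n. anorm A (adiff A (t n) (s n)) \<le> f n" "f \<longlonglongrightarrow> 0"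
  shows "tends_to A t x"
proof (rule tends_toI)
  show "(\<lambda>n. f n + anorm A (adiff A (s n) x)) \<longlonglongrightarrow> 0"
    using tendsto_add[OF assms(4) tends_toD(3)[OF assms(1)]] by simp
  show "anorm A (adiff A (t n) x) \<le> f n + anorm A (adiff A (s n) x)" for n
    using dist_triangle[of "t n" "s n" x] assms(2,3)[of n] tends_toD(1,2)[OF assms(1)]
    by (smt (verit))
qed (use assms in \<open>auto simp: tends_toD\<close>)

lemma is_cauchyI:
  assumes "\<And>n. s n \<in> acarrier A"
    and "\<And>e. e > 0 \<Longrightarrow> \<exists>N. \<forall>m\<ge>N. \<forall>n\<ge>N. anorm A (adiff A (s m) (s n)) < e"
  shows "is_cauchy A s"
  using assms by (auto simp: is_cauchy_def)

lemma is_cauchy_perturb: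
  assumes "is_cauchy A s" "\<And>n. t n \<in> acarrier A"
    and "\<And>n. anorm A (adiff A (t n) (s n)) \<le> f n" "f \<longlonglongrightarrow> 0"
  shows "is_cauchy A t"
proof (rule is_cauchyI)
  fix e :: real assume "e > 0"
  then obtain N1 where N1: "\<And>m n. \<lbrakk>m \<ge> N1; n \<ge> N1\<rbrakk> \<Longrightarrow> anorm A (adiff A (s m) (s n)) < e/3"
    using assms(1) unfolding is_cauchy_def by (meson divide_pos_pos zero_less_numeral)
  obtain N2 where N2: "f n < e/3" if "n \<ge> N2" for n
    using order_tendstoD(2)[OF assms(4), of "e/3"] \<open>e > 0\<close>
    by (auto simp: eventually_sequentially)
  have "anorm A (adiff A (t m) (t n)) < e" if "m \<ge> max N1 N2" "n \<ge> max N1 N2" for m n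
  proof -
    have s: "s k \<in> acarrier A" for k using assms(1) by (rule is_cauchy_closed)
    have "anorm A (adiff A (t m) (t n)) \<le> anorm A (adiff A (t m) (s m)) +
        (anorm A (adiff A (s m) (s n)) + anorm A (adiff A (t n) (s n)))"
      using dist_triangle[of "t m" "s m" "t n"] dist_triangle[of "s m" "s n" "t n"]
        dist_commute[of "s n" "t n"] s assms(2) by simp
    then show ?thesis
      using N1[of m n] N2[of m] N2[of n] assms(3)[of m] assms(3)[of n] that by linarith
  qed
  then show "\<exists>N. \<forall>m\<ge>N. \<forall>n\<ge>N. anorm A (adiff A (t m) (t n)) < e" by blast
qed (rule assms)

lemma tends_to_imp_cauchy:
  assumes "tends_to A s x" shows "is_cauchy A s"
proof (rule is_cauchy_perturb)
  show "is_cauchy A (\<lambda>n. x)"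
    using assms by (intro is_cauchyI) (auto simp: tends_toD diff_self norm_zero)
  show "(\<lambda>n. anorm A (adiff A (s n) x)) \<longlonglongrightarrow> 0" using assms by (rule tends_toD)
qed (use assms in \<open>auto simp: tends_toD\<close>)

lemma is_cauchy_norm_convergent:
  assumes "is_cauchy A s" shows "convergent (\<lambda>n. anorm A (s n))"
proof -
  have "Cauchy (\<lambda>n. anorm A (s n))"
  proof (rule CauchyI)
    fix e :: real assume "e > 0"
    then obtain N where N: "anorm A (adiff A (s m) (s n)) < e" if "m \<ge> N" "n \<ge> N" for m n
      using assms unfolding is_cauchy_def by meson
    have "norm (anorm A (s m) - anorm A (s n)) < e" if "m \<ge> N" "n \<ge> N" for m n
      using norm_dist[of "s m" "s n"] N[OF that] is_cauchy_closed[OF assms] by force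
    then show "\<exists>N. \<forall>m\<ge>N. \<forall>n\<ge>N. norm (anorm A (s m) - anorm A (s n)) < e" by blast
  qed
  then show ?thesis by (rule Cauchy_convergent)
qed

lemma is_cauchy_norm_bounded:
  assumes "is_cauchy A s"
  obtains M where "M > 0" "\<And>n. anorm A (s n) \<le> M"
proof -
  obtain M where "M > 0" "\<And>n. norm (anorm A (s n)) \<le> M"
    using convergent_imp_Bseq[OF is_cauchy_norm_convergent[OF assms]] by (auto elim: BseqE)
  then show thesis
    by (intro that[of M]) (auto dest: abs_le_D1 simp: real_norm_def)
qed

lemma is_cauchy_add:
  assumes "is_cauchy A s" "is_cauchy A t" shows "is_cauchy A (\<lambda>n. aadd A (s n) (t n))"
proof (rule is_cauchyI)
  fix e :: real assume "e > 0"
  then obtain N1 N2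
    where N1: "\<And>m n. \<lbrakk>m \<ge> N1; n \<ge> N1\<rbrakk> \<Longrightarrow> anorm A (adiff A (s m) (s n)) < e/2"
      and N2: "\<And>m n. \<lbrakk>m \<ge> N2; n \<ge> N2\<rbrakk> \<Longrightarrow> anorm A (adiff A (t m) (t n)) < e/2"
    using assms unfolding is_cauchy_def by (meson half_gt_zero)
  have "anorm A (adiff A (aadd A (s m) (t m)) (aadd A (s n) (t n))) < e"
    if "m \<ge> max N1 N2" "n \<ge> max N1 N2" for m n
    using dist_add[of "s m" "s n" "t m" "t n"] N1[of m n] N2[of m n] that
      is_cauchy_closed[OF assms(1)] is_cauchy_closed[OF assms(2)] by force
  then show "\<exists>N. \<forall>m\<ge>N. \<forall>n\<ge>N.
      anorm A (adiff A (aadd A (s m) (t m)) (aadd A (s n) (t n))) < e" by blast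
qed (use assms in \<open>simp add: closed is_cauchy_closed\<close>)

lemma is_cauchy_mult:
  assumes "is_cauchy A s" "is_cauchy A t" shows "is_cauchy A (\<lambda>n. amult A (s n) (t n))"
proof (rule is_cauchyI)
  obtain M1 where M1: "M1 > 0" "\<And>n. anorm A (s n) \<le> M1"
    using is_cauchy_norm_bounded[OF assms(1)] by blast
  obtain M2 where M2: "M2 > 0" "\<And>n. anorm A (t n) \<le> M2"
    using is_cauchy_norm_bounded[OF assms(2)] by blast
  fix e :: real assume "e > 0"
  then have "e / (2 * M2) > 0" "e / (2 * M1) > 0" using M1 M2 by simp_all
  then obtain N1 N2
    where N1: "\<And>m n. \<lbrakk>m \<ge> N1; n \<ge> N1\<rbrakk> \<Longrightarrow> anorm A (adiff A (s m) (s n)) < e / (2 * M2)"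
      and N2: "\<And>m n. \<lbrakk>m \<ge> N2; n \<ge> N2\<rbrakk> \<Longrightarrow> anorm A (adiff A (t m) (t n)) < e / (2 * M1)"
    using assms unfolding is_cauchy_def by meson
  have "anorm A (adiff A (amult A (s m) (t m)) (amult A (s n) (t n))) < e"
    if mn: "m \<ge> max N1 N2" "n \<ge> max N1 N2" for m n
  proof -
    have c: "s k \<in> acarrier A" "t k \<in> acarrier A" for k
      using assms is_cauchy_closed by auto
    have "anorm A (s m) * anorm A (adiff A (t m) (t n)) \<le> M1 * anorm A (adiff A (t m) (t n))"
      using M1(2)[of m] c by (simp add: mult_right_mono norm_nonneg closed)
    also have "\<dots> < e / 2" using N2[of m n] mn M1(1) by (simp add: field_simps)
    finally have 1: "anorm A (s m) * anorm A (adiff A (t m) (t n)) < e / 2" .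
    have "anorm A (adiff A (s m) (s n)) * anorm A (t n) \<le> anorm A (adiff A (s m) (s n)) * M2"
      using M2(2)[of n] c by (simp add: mult_left_mono norm_nonneg closed)
    also have "\<dots> < e / 2" using N1[of m n] mn M2(1) by (simp add: field_simps)
    finally show ?thesis
      using 1 dist_mult[of "s m" "s n" "t m" "t n"] c by simp
  qed
  then show "\<exists>N. \<forall>m\<ge>N. \<forall>n\<ge>N.
      anorm A (adiff A (amult A (s m) (t m)) (amult A (s n) (t n))) < e" by blast
qed (use assms in \<open>simp add: closed is_cauchy_closed\<close>)

lemma is_cauchy_scale:
  assumes "is_cauchy A s" shows "is_cauchy A (\<lambda>n. ascale A c (s n))"
proof (rule is_cauchyI)
  fix e :: real assume "e > 0"
  then have "e / (cmod c + 1) > 0" by (simp add: add_nonneg_pos)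
  then obtain N where N: "anorm A (adiff A (s m) (s n)) < e / (cmod c + 1)"
    if "m \<ge> N" "n \<ge> N" for m n
    using assms unfolding is_cauchy_def by meson
  have "anorm A (adiff A (ascale A c (s m)) (ascale A c (s n))) < e" if "m \<ge> N" "n \<ge> N" for m n
  proof -
    have c: "s k \<in> acarrier A" for k using assms by (rule is_cauchy_closed)
    have "cmod c * anorm A (adiff A (s m) (s n)) \<le> (cmod c + 1) * anorm A (adiff A (s m) (s n))"
      using c by (intro mult_right_mono) (auto simp: norm_nonneg closed)
    also have "\<dots> < e"
      using N[OF that] by (simp add: pos_less_divide_eq add_nonneg_pos mult.commute)
    finally show ?thesis using c by (simp add: dist_scale)
  qed
  then show "\<exists>N. \<forall>m\<ge>N. \<forall>n\<ge>N. anorm A (adiff A (ascale A c (s m)) (ascale A c (s n))) < e"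
    by blast
qed (use assms in \<open>simp add: closed is_cauchy_closed\<close>)

end

context normed_algebra
begin

lemma tends_to_unique:
  assumes "tends_to A s x" "tends_to A s y" shows "x = y"
proof -
  have "tends_to A (\<lambda>n. adiff A (s n) (s n)) (adiff A x y)"
    using assms by (rule tends_to_diff)
  then have "(\<lambda>n. anorm A (adiff A (s n) (s n))) \<longlonglongrightarrow> anorm A (adiff A x y)"
    by (rule tends_to_norm)
  then have "(\<lambda>n::nat. 0) \<longlonglongrightarrow> anorm A (adiff A x y)"
    using tends_toD(1)[OF assms(1)] by (simp add: diff_self norm_zero)
  then have "anorm A (adiff A x y) = 0"
    by (simp add: LIMSEQ_const_iff)
  then show ?thesis
    using assms by (simp add: norm_eq_zero closed diff_eq_zero_iff tends_toD)
qed

interpretation M: Metric_space "acarrier A" "adist A"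
  by (rule Metric_space_adist)

lemma closure_of_iff:
  assumes "S \<subseteq> acarrier A"
  shows "x \<in> atopology A closure_of S \<longleftrightarrow>
    x \<in> acarrier A \<and> (\<forall>e>0. \<exists>y\<in>S. anorm A (adiff A y x) < e)"
proof -
  have "adist A x y = anorm A (adiff A y x)" if "x \<in> acarrier A" "y \<in> S" for y
    using that assms by (auto simp: adist_def dist_commute)
  then show ?thesis
    using assms unfolding atopology_def M.metric_closure_of by (auto simp: subset_iff)
qed

lemma closure_of_iff_tends_to:
  assumes "S \<subseteq> acarrier A"
  shows "x \<in> atopology A closure_of S \<longleftrightarrow> (\<exists>s. range s \<subseteq> S \<and> tends_to A s x)"
proof
  assume x: "x \<in> atopology A closure_of S"
  then have "\<forall>n. \<exists>y\<in>S. anorm A (adiff A y x) < inverse (real (Suc n))"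
    using assms by (simp add: closure_of_iff)
  then obtain s where s: "\<And>n. s n \<in> S" "\<And>n. anorm A (adiff A (s n) x) < inverse (real (Suc n))"
    by metis
  have "tends_to A s x"
    using s assms x by (intro tends_toI[OF _ _ _ LIMSEQ_inverse_real_of_nat])
      (auto simp: closure_of_iff less_imp_le)
  then show "\<exists>s. range s \<subseteq> S \<and> tends_to A s x" using s by blast
next
  assume "\<exists>s. range s \<subseteq> S \<and> tends_to A s x"
  then obtain s where s: "range s \<subseteq> S" "tends_to A s x" by blast
  have "\<exists>y\<in>S. anorm A (adiff A y x) < e" if "e > 0" for e
    using order_tendstoD(2)[OF tends_toD(3)[OF s(2)] that] s(1)
    by (auto simp: eventually_sequentially)
  then show "x \<in> atopology A closure_of S"
    using assms s(2) by (simp add: closure_of_iff tends_toD)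
qed

lemma topspace_atopology: "topspace (atopology A) = acarrier A"
  by (simp add: atopology_def)

lemma closedin_iff_tends_to:
  "closedin (atopology A) S \<longleftrightarrow>
    S \<subseteq> acarrier A \<and> (\<forall>s x. range s \<subseteq> S \<longrightarrow> tends_to A s x \<longrightarrow> x \<in> S)"
proof (cases "S \<subseteq> acarrier A")
  case True
  then have "closedin (atopology A) S \<longleftrightarrow> atopology A closure_of S \<subseteq> S"
    by (metis closure_of_eq closure_of_subset topspace_atopology subset_antisym order_refl)
  then show ?thesis
    using True closure_of_iff_tends_to[OF True] by (simp add: subset_iff[of _ S]) blast
qed (use topspace_atopology closedin_subset in blast)

lemma closedin_tends_toD:
  assumes "closedin (atopology A) S" "\<And>n. s n \<in> S" "tends_to A s x"
  shows "x \<in> S"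
proof -
  have "range s \<subseteq> S" using assms(2) by blast
  then show ?thesis using assms(1,3) by (simp add: closedin_iff_tends_to)
qed

lemma mcomplete_iff:
  "M.mcomplete \<longleftrightarrow> (\<forall>s. is_cauchy A s \<longrightarrow> (\<exists>x. tends_to A s x))"
proof -
  have 1: "M.MCauchy s \<longleftrightarrow> is_cauchy A s" for s
    unfolding M.MCauchy_def is_cauchy_def adist_def by (auto simp: image_subset_iff)
  have 2: "limitin M.mtopology s x sequentially \<longleftrightarrow> tends_to A s x" if "is_cauchy A s" for s x
  proof -
    have s: "s n \<in> acarrier A" for n using that by (rule is_cauchy_closed)
    have "\<bar>anorm A (adiff A (s n) x)\<bar> = anorm A (adiff A (s n) x)" if "x \<in> acarrier A" for n
      using s that by (simp add: norm_nonneg closed)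
    then show ?thesis
      unfolding M.limit_metric_sequentially tends_to_def adist_def LIMSEQ_iff
      using s by auto
  qed
  show ?thesis
    unfolding M.mcomplete_def using 1 2 by blast
qed

end

lemma BA_iff:
  "A \<in> BA \<longleftrightarrow> normed_algebra A \<and> (\<forall>s. is_cauchy A s \<longrightarrow> (\<exists>x. tends_to A s x))"
  using normed_algebra.mcomplete_iff by (auto simp: BA_def)

lemma continuous_map_atopology_iff:
  assumes "normed_algebra A" "normed_algebra B"
  shows "continuous_map (atopology A) (atopology B) f \<longleftrightarrow>
    f \<in> acarrier A \<rightarrow> acarrier B \<and>
    (\<forall>a\<in>acarrier A. \<forall>e>0. \<exists>d>0. \<forall>x\<in>acarrier A.
      anorm A (adiff A a x) < d \<longrightarrow> anorm B (adiff B (f a) (f x)) < e)"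
proof -
  interpret MA: Metric_space "acarrier A" "adist A"
    using assms(1) by (rule normed_algebra.Metric_space_adist)
  have MB: "Metric_space (acarrier B) (adist B)"
    using assms(2) by (rule normed_algebra.Metric_space_adist)
  show ?thesis
  proof (cases "f \<in> acarrier A \<rightarrow> acarrier B")
    case True
    then have "f x \<in> acarrier B" if "x \<in> acarrier A" for x using that by auto
    then show ?thesis
      unfolding atopology_def MA.metric_continuous_map[OF MB]
      using True by (simp add: adist_def Ball_def image_subset_iff imp_conjL cong: conj_cong imp_cong)
  next
    case False
    then show ?thesis
      unfolding atopology_def MA.metric_continuous_map[OF MB] by auto
  qed
qed

section \<open>Homomorphisms\<close>

lemma alg_homD:
  assumes "alg_hom A B f"
  shows "x \<in> acarrier A \<Longrightarrow> f x \<in> acarrier B"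
    and "\<lbrakk>x \<in> acarrier A; y \<in> acarrier A\<rbrakk> \<Longrightarrow> f (aadd A x y) = aadd B (f x) (f y)"
    and "\<lbrakk>x \<in> acarrier A; y \<in> acarrier A\<rbrakk> \<Longrightarrow> f (amult A x y) = amult B (f x) (f y)"
    and "x \<in> acarrier A \<Longrightarrow> f (ascale A c x) = ascale B c (f x)"
  using assms by (auto simp: alg_hom_def)

lemma alg_hom_zero:
  assumes "normed_algebra A" "normed_algebra B" "alg_hom A B f"
  shows "f (azero A) = azero B"
proof -
  interpret A: normed_algebra A by fact
  interpret B: normed_algebra B by fact
  have "f (ascale A 0 (azero A)) = ascale B 0 (f (azero A))"
    using A.zero_closed alg_homD(4)[OF assms(3)] by blast
  then show ?thesis
    using A.zero_closed alg_homD(1)[OF assms(3)] by (simp add: A.scale_zero_left B.scale_zero_left)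
qed

lemma alg_hom_diff:
  assumes "normed_algebra A" "alg_hom A B f" "x \<in> acarrier A" "y \<in> acarrier A"
  shows "f (adiff A x y) = adiff B (f x) (f y)"
proof -
  interpret A: normed_algebra A by fact
  show ?thesis
    using assms by (simp add: adiff_def alg_homD[OF assms(2)] A.closed)
qed

lemma alg_hom_compose:
  "alg_hom A B f \<Longrightarrow> alg_hom B C g \<Longrightarrow> alg_hom A C (\<lambda>x. g (f x))"
  by (auto simp: alg_hom_def Pi_iff)

lemma alg_hom_inv_into:
  assumes "normed_algebra A" "alg_hom A B f" "bij_betw f (acarrier A) (acarrier B)"
  shows "alg_hom B A (inv_into (acarrier A) f)"
proof -
  interpret A: normed_algebra A by fact
  have B: "acarrier B = f ` acarrier A" and inj: "inj_on f (acarrier A)"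
    using assms(3) by (auto simp: bij_betw_def)
  show ?thesis
    unfolding alg_hom_def B
    using inv_into_f_f[OF inj] by (auto simp: A.closed simp flip: alg_homD(2-4)[OF assms(2)])
qed

text \<open>
  A linear map that is continuous at 0 is smaller than 1 on some ball of radius \<open>d\<close>, and every vector
  can be scaled to norm \<open>d / 2\<close>.
\<close>

lemma alg_hom_bounded:
  assumes "normed_algebra A" "normed_algebra B" "alg_hom A B f"
    and cont: "continuous_map (atopology A) (atopology B) f"
  obtains M where "M > 0" "\<And>x. x \<in> acarrier A \<Longrightarrow> anorm B (f x) \<le> M * anorm A x"
proof -
  interpret A: normed_algebra A by fact
  interpret B: normed_algebra B by fact
  obtain d where d: "d > 0"
    and small: "\<And>x. x \<in> acarrier A \<Longrightarrow> anorm A (adiff A (azero A) x) < d \<Longrightarrow>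
      anorm B (adiff B (f (azero A)) (f x)) < 1"
    using cont A.zero_closed unfolding continuous_map_atopology_iff[OF assms(1,2)]
    by (meson zero_less_one)
  have small: "anorm B (f x) < 1" if "x \<in> acarrier A" "anorm A x < d" for x
    using small[OF that(1)] that alg_homD(1)[OF assms(3) that(1)]
    by (simp add: alg_hom_zero[OF assms(1-3)] A.dist_commute[OF A.zero_closed]
        B.dist_commute[OF B.zero_closed] A.diff_zero B.diff_zero)
  have "anorm B (f x) \<le> 2 / d * anorm A x" if x: "x \<in> acarrier A" for x
  proof (cases "anorm A x = 0")
    case True
    then show ?thesis
      using x by (simp add: A.norm_eq_zero alg_hom_zero[OF assms(1-3)] A.norm_zero B.norm_zero)
  next
    case False
    then have pos: "anorm A x > 0" using A.norm_nonneg[OF x] by simp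
    define c where "c = complex_of_real (d / (2 * anorm A x))"
    have c: "cmod c = d / (2 * anorm A x)"
      using pos d by (simp add: c_def norm_divide norm_mult)
    have "anorm A (ascale A c x) < d"
      using pos d x by (simp add: A.norm_scale c)
    then have "anorm B (ascale B c (f x)) < 1"
      using small[of "ascale A c x"] x by (simp add: A.closed alg_homD(4)[OF assms(3)])
    then have "cmod c * anorm B (f x) < 1"
      using x by (simp add: B.norm_scale alg_homD(1)[OF assms(3)])
    then show ?thesis
      using pos d by (simp add: c field_simps)
  qed
  then show thesis using d by (intro that[of "2 / d"]) auto
qed

lemma topological_iso_iff:
  assumes "normed_algebra A" "normed_algebra B"
  shows "topological_iso A B f \<longleftrightarrow>
    alg_hom A B f \<and> bij_betw f (acarrier A) (acarrier B) \<and>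
    (\<exists>c>0. \<exists>M>0. \<forall>x\<in>acarrier A. c * anorm A x \<le> anorm B (f x) \<and> anorm B (f x) \<le> M * anorm A x)"
    (is "?L \<longleftrightarrow> ?R")
proof
  interpret A: normed_algebra A by fact
  interpret B: normed_algebra B by fact
  let ?g = "inv_into (acarrier A) f"
  {
    assume L: ?L
    then have hom: "alg_hom A B f" and bij: "bij_betw f (acarrier A) (acarrier B)"
      and cont: "continuous_map (atopology A) (atopology B) f"
        "continuous_map (atopology B) (atopology A) ?g"
      by (auto simp: topological_iso_def)
    obtain M where M: "M > 0" "\<And>x. x \<in> acarrier A \<Longrightarrow> anorm B (f x) \<le> M * anorm A x"
      using alg_hom_bounded[OF assms hom cont(1)] by blast
    obtain K where K: "K > 0" "\<And>y. y \<in> acarrier B \<Longrightarrow> anorm A (?g y) \<le> K * anorm B y"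
      using alg_hom_bounded[OF assms(2,1) alg_hom_inv_into[OF assms(1) hom bij] cont(2)] by blast
    have "inverse K * anorm A x \<le> anorm B (f x)" if "x \<in> acarrier A" for x
      using K(2)[of "f x"] that K(1) bij alg_homD(1)[OF hom that]
      by (simp add: bij_betw_inv_into_left field_simps)
    then show ?R
      using hom bij M K(1) by (metis positive_imp_inverse_positive)
  }
  assume R: ?R
  then obtain c M where hom: "alg_hom A B f" and bij: "bij_betw f (acarrier A) (acarrier B)"
    and c: "c > 0" "\<And>x. x \<in> acarrier A \<Longrightarrow> c * anorm A x \<le> anorm B (f x)"
    and M: "M > 0" "\<And>x. x \<in> acarrier A \<Longrightarrow> anorm B (f x) \<le> M * anorm A x"
    by blast
  have lip: "continuous_map (atopology A) (atopology B) f"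
    if "normed_algebra A" "normed_algebra B" "alg_hom A B f" "M > 0"
      and M: "\<And>x. x \<in> acarrier A \<Longrightarrow> anorm B (f x) \<le> M * anorm A x"
    for A B :: "'a nalg" and f and M :: real
    unfolding continuous_map_atopology_iff[OF that(1,2)]
  proof (intro conjI ballI allI impI)
    fix a and e :: real assume a: "a \<in> acarrier A" and "e > 0"
    interpret A: normed_algebra A by fact
    have "anorm B (adiff B (f a) (f x)) < e" if "x \<in> acarrier A" "anorm A (adiff A a x) < e / M" for x
      using M[of "adiff A a x"] that a \<open>M > 0\<close> alg_hom_diff[OF \<open>normed_algebra A\<close> \<open>alg_hom A B f\<close>]
      by (simp add: A.closed field_simps)
    then show "\<exists>d>0. \<forall>x\<in>acarrier A.
        anorm A (adiff A a x) < d \<longrightarrow> anorm B (adiff B (f a) (f x)) < e"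
      using \<open>e > 0\<close> \<open>M > 0\<close> by (intro exI[of _ "e / M"]) simp
  qed (use alg_homD(1)[OF that(3)] in auto)
  have "anorm A (?g y) \<le> inverse c * anorm B y" if y: "y \<in> acarrier B" for y
    using c(2)[of "?g y"] c(1) bij y
    by (simp add: bij_betw_inv_into_right bij_betw_apply[OF bij_betw_inv_into] field_simps)
  then have "continuous_map (atopology B) (atopology A) ?g"
    using c(1) alg_hom_inv_into[OF assms(1) hom bij] by (intro lip[where M = "inverse c"] assms) auto
  then show ?L
    unfolding topological_iso_def using hom bij lip[OF assms hom M] by blast
qed

lemma topological_iso_isometry:
  assumes "normed_algebra A" "normed_algebra B" "alg_hom A B f" "f ` acarrier A = acarrier B"
    and iso: "\<And>x. x \<in> acarrier A \<Longrightarrow> anorm B (f x) = anorm A x"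
  shows "topological_iso A B f"
proof -
  interpret A: normed_algebra A by fact
  interpret B: normed_algebra B by fact
  have "inj_on f (acarrier A)"
  proof (rule inj_onI)
    fix x y assume xy: "x \<in> acarrier A" "y \<in> acarrier A" "f x = f y"
    then have "anorm A (adiff A x y) = 0"
      using iso[of "adiff A x y"] alg_homD(1)[OF assms(3)]
      by (simp add: A.closed alg_hom_diff[OF assms(1,3)] B.diff_self B.norm_zero)
    then show "x = y"
      using xy by (simp add: A.norm_eq_zero A.closed A.diff_eq_zero_iff)
  qed
  then show ?thesis
    unfolding topological_iso_iff[OF assms(1,2)]
    using assms by (auto simp: bij_betw_def intro!: exI[of _ 1])
qed

section \<open>Completions\<close>

text \<open>
  Take for \<open>\<phi> x\<close> the image under \<open>e\<close> of a chosen element of the class \<open>{y. \<bar>x - y\<bar> = 0}\<close>.  The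
  operations respect these classes because they are continuous in the seminorm.
\<close>

lemma ex_hausdorff_quotient:
  fixes D :: "'b nalg" and e :: "'b \<Rightarrow> 'a"
  assumes "seminormed_algebra D" "inj e"
  obtains B :: "'a nalg" and \<phi>
  where "normed_algebra B" "acarrier B = \<phi> ` acarrier D"
    "\<And>x y. \<lbrakk>x \<in> acarrier D; y \<in> acarrier D\<rbrakk> \<Longrightarrow> aadd B (\<phi> x) (\<phi> y) = \<phi> (aadd D x y)"
    "\<And>x y. \<lbrakk>x \<in> acarrier D; y \<in> acarrier D\<rbrakk> \<Longrightarrow> amult B (\<phi> x) (\<phi> y) = \<phi> (amult D x y)"
    "\<And>c x. x \<in> acarrier D \<Longrightarrow> ascale B c (\<phi> x) = \<phi> (ascale D c x)"
    "\<And>x. x \<in> acarrier D \<Longrightarrow> anorm B (\<phi> x) = anorm D x"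
proof -
  interpret D: seminormed_algebra D by fact
  define rep where "rep x = (SOME y. y \<in> acarrier D \<and> anorm D (adiff D x y) = 0)" for x
  define \<phi> where "\<phi> x = e (rep x)" for x
  have rep: "rep x \<in> acarrier D" "anorm D (adiff D x (rep x)) = 0" if "x \<in> acarrier D" for x
    using someI[of "\<lambda>y. y \<in> acarrier D \<and> anorm D (adiff D x y) = 0" x] that
    by (auto simp: rep_def D.diff_self D.norm_zero)
  have \<phi>_eqI: "\<phi> x = \<phi> y"
    if x: "x \<in> acarrier D" and y: "y \<in> acarrier D" and xy: "anorm D (adiff D x y) = 0" for x y
  proof -
    have "anorm D (adiff D x z) = anorm D (adiff D y z)" if z: "z \<in> acarrier D" for z
      using D.dist_triangle[OF x y z] D.dist_triangle[OF y x z] D.dist_commute[OF x y] xy by simp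
    then have "rep x = rep y"
      unfolding rep_def by metis
    then show ?thesis by (simp add: \<phi>_def)
  qed
  define \<psi> where "\<psi> = inv_into (acarrier D) \<phi>"
  have \<psi>: "\<psi> (\<phi> x) \<in> acarrier D" "anorm D (adiff D (\<psi> (\<phi> x)) x) = 0" if x: "x \<in> acarrier D" for x
  proof -
    show 1: "\<psi> (\<phi> x) \<in> acarrier D"
      unfolding \<psi>_def using x by (intro inv_into_into) auto
    have "\<phi> (\<psi> (\<phi> x)) = \<phi> x"
      unfolding \<psi>_def using x by (intro f_inv_into_f) auto
    then have eq: "rep (\<psi> (\<phi> x)) = rep x"
      using assms(2) by (auto simp: \<phi>_def inj_def)
    have "anorm D (adiff D (\<psi> (\<phi> x)) x)
        \<le> anorm D (adiff D (\<psi> (\<phi> x)) (rep x)) + anorm D (adiff D (rep x) x)"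
      using 1 x rep(1)[OF x] by (intro D.dist_triangle)
    also have "\<dots> = 0"
      using rep(2)[OF 1] rep[OF x] D.dist_commute[OF x] by (simp add: eq)
    finally show "anorm D (adiff D (\<psi> (\<phi> x)) x) = 0"
      using D.norm_nonneg[OF D.diff_closed[OF 1 x]] by simp
  qed
  define B where "B = \<lparr>acarrier = \<phi> ` acarrier D,
     aadd = (\<lambda>x y. \<phi> (aadd D (\<psi> x) (\<psi> y))),
     amult = (\<lambda>x y. \<phi> (amult D (\<psi> x) (\<psi> y))),
     azero = \<phi> (azero D),
     ascale = (\<lambda>c x. \<phi> (ascale D c (\<psi> x))),
     anorm = (\<lambda>x. anorm D (\<psi> x))\<rparr>"
  have carrier: "acarrier B = \<phi> ` acarrier D" and zero: "azero B = \<phi> (azero D)"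
    by (simp_all add: B_def)
  have add: "aadd B (\<phi> x) (\<phi> y) = \<phi> (aadd D x y)"
    and mult: "amult B (\<phi> x) (\<phi> y) = \<phi> (amult D x y)"
    if x: "x \<in> acarrier D" and y: "y \<in> acarrier D" for x y
  proof -
    note cl = x y \<psi>(1)[OF x] \<psi>(1)[OF y]
    have "anorm D (adiff D (aadd D (\<psi> (\<phi> x)) (\<psi> (\<phi> y))) (aadd D x y)) \<le> 0"
      using D.dist_add[of "\<psi> (\<phi> x)" x "\<psi> (\<phi> y)" y] cl by (simp add: \<psi>(2))
    then have "anorm D (adiff D (aadd D (\<psi> (\<phi> x)) (\<psi> (\<phi> y))) (aadd D x y)) = 0"
      using cl by (intro antisym D.norm_nonneg D.closed)
    then show "aadd B (\<phi> x) (\<phi> y) = \<phi> (aadd D x y)"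
      unfolding B_def using cl by (auto intro!: \<phi>_eqI D.closed)
    have "anorm D (adiff D (amult D (\<psi> (\<phi> x)) (\<psi> (\<phi> y))) (amult D x y)) \<le> 0"
      using D.dist_mult[of "\<psi> (\<phi> x)" x "\<psi> (\<phi> y)" y] cl by (simp add: \<psi>(2))
    then have "anorm D (adiff D (amult D (\<psi> (\<phi> x)) (\<psi> (\<phi> y))) (amult D x y)) = 0"
      using cl by (intro antisym D.norm_nonneg D.closed)
    then show "amult B (\<phi> x) (\<phi> y) = \<phi> (amult D x y)"
      unfolding B_def using cl by (auto intro!: \<phi>_eqI D.closed)
  qed
  have scale: "ascale B c (\<phi> x) = \<phi> (ascale D c x)" if x: "x \<in> acarrier D" for c x
    unfolding B_def using x \<psi>[OF x] by (auto intro!: \<phi>_eqI D.closed simp: D.dist_scale)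
  have norm: "anorm B (\<phi> x) = anorm D x" if x: "x \<in> acarrier D" for x
    using D.norm_dist[OF \<psi>(1)[OF x] x] \<psi>(2)[OF x] by (simp add: B_def)
  have "normed_algebra B"
    by (rule normed_algebra_surjective_image[OF assms(1) carrier zero add mult scale norm])
      (auto intro!: \<phi>_eqI simp: D.closed D.diff_zero)
  then show thesis
    using carrier add mult scale norm by (rule that)
qed

definition cauchy_alg :: "'a nalg \<Rightarrow> (nat \<Rightarrow> 'a) nalg"
  where "cauchy_alg A =
    \<lparr>acarrier = {s. is_cauchy A s},
     aadd = (\<lambda>s t n. aadd A (s n) (t n)),
     amult = (\<lambda>s t n. amult A (s n) (t n)),
     azero = (\<lambda>n. azero A),
     ascale = (\<lambda>c s n. ascale A c (s n)),
     anorm = (\<lambda>s. lim (\<lambda>n. anorm A (s n)))\<rparr>"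

lemma seminormed_cauchy_alg:
  assumes "seminormed_algebra A" shows "seminormed_algebra (cauchy_alg A)"
proof -
  interpret A: seminormed_algebra A by fact
  have lim: "(\<lambda>n. anorm A (s n)) \<longlonglongrightarrow> lim (\<lambda>n. anorm A (s n))" if "is_cauchy A s" for s
    using A.is_cauchy_norm_convergent[OF that] by (simp add: convergent_LIMSEQ_iff)
  show ?thesis
  proof
    fix s t assume "s \<in> acarrier (cauchy_alg A)" "t \<in> acarrier (cauchy_alg A)"
    then have st: "is_cauchy A s" "is_cauchy A t" by (auto simp: cauchy_alg_def)
    note cl = is_cauchy_closed[OF st(1)] is_cauchy_closed[OF st(2)]
    show "aadd (cauchy_alg A) s t = aadd (cauchy_alg A) t s"
      using cl A.add_commute by (simp add: cauchy_alg_def)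
    have "lim (\<lambda>n. anorm A (aadd A (s n) (t n)))
        \<le> lim (\<lambda>n. anorm A (s n)) + lim (\<lambda>n. anorm A (t n))"
      by (rule LIMSEQ_le[OF lim[OF A.is_cauchy_add[OF st]] tendsto_add[OF lim lim]])
        (use st cl in \<open>auto simp: A.norm_triangle\<close>)
    then show "anorm (cauchy_alg A) (aadd (cauchy_alg A) s t)
        \<le> anorm (cauchy_alg A) s + anorm (cauchy_alg A) t"
      by (simp add: cauchy_alg_def)
    have "lim (\<lambda>n. anorm A (amult A (s n) (t n)))
        \<le> lim (\<lambda>n. anorm A (s n)) * lim (\<lambda>n. anorm A (t n))"
      by (rule LIMSEQ_le[OF lim[OF A.is_cauchy_mult[OF st]] tendsto_mult[OF lim lim]])
        (use st cl in \<open>auto simp: A.norm_mult\<close>)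
    then show "anorm (cauchy_alg A) (amult (cauchy_alg A) s t)
        \<le> anorm (cauchy_alg A) s * anorm (cauchy_alg A) t"
      by (simp add: cauchy_alg_def)
  next
    fix s c assume "s \<in> acarrier (cauchy_alg A)"
    then have s: "is_cauchy A s" by (auto simp: cauchy_alg_def)
    have "lim (\<lambda>n. cmod c * anorm A (s n)) = cmod c * lim (\<lambda>n. anorm A (s n))"
      by (intro limI tendsto_mult_left lim s)
    then show "anorm (cauchy_alg A) (ascale (cauchy_alg A) c s) = cmod c * anorm (cauchy_alg A) s"
      using is_cauchy_closed[OF s] by (simp add: cauchy_alg_def A.norm_scale)
  next
    show "azero (cauchy_alg A) \<in> acarrier (cauchy_alg A)"
      using A.tends_to_imp_cauchy[OF A.tends_to_const[OF A.zero_closed]] by (simp add: cauchy_alg_def)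
  qed (auto simp: cauchy_alg_def A.is_cauchy_add A.is_cauchy_mult A.is_cauchy_scale is_cauchy_closed
      A.add_assoc A.mult_assoc A.add_zero A.add_neg A.scale_add_right A.scale_add_left A.scale_scale
      A.scale_one A.mult_add_left A.mult_add_right A.mult_scale_left A.mult_scale_right)
qed

lemma is_cauchy_dominated:
  assumes "is_cauchy A s" "normed_algebra B" "\<And>n. t n \<in> acarrier B"
    and "\<And>m n. anorm B (adiff B (t m) (t n)) \<le> K * anorm A (adiff A (s m) (s n))" "K > 0"
  shows "is_cauchy B t"
proof -
  interpret B: normed_algebra B by fact
  show ?thesis
  proof (rule B.is_cauchyI)
    fix e :: real assume "e > 0"
    then obtain N where N: "\<And>m n. \<lbrakk>m \<ge> N; n \<ge> N\<rbrakk> \<Longrightarrow> anorm A (adiff A (s m) (s n)) < e / K"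
      using assms(1,5) unfolding is_cauchy_def by (meson divide_pos_pos)
    have "anorm B (adiff B (t m) (t n)) < e" if "m \<ge> N" "n \<ge> N" for m n
      using N[OF that] assms(4)[of m n] \<open>K > 0\<close> by (simp add: field_simps)
    then show "\<exists>N. \<forall>m\<ge>N. \<forall>n\<ge>N. anorm B (adiff B (t m) (t n)) < e" by blast
  qed (rule assms)
qed

text \<open>
  Every element of \<open>B\<close> can be approximated by elements of \<open>S\<close>, so a Cauchy sequence of \<open>B\<close> has the same
  limit as a sequence of \<open>S\<close> that is asymptotic to it.
\<close>

lemma complete_if_dense:
  assumes "normed_algebra B" "S \<subseteq> acarrier B" "atopology B closure_of S = acarrier B"
    and lim: "\<And>s. \<lbrakk>range s \<subseteq> S; is_cauchy B s\<rbrakk> \<Longrightarrow> \<exists>x. tends_to B s x"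
  shows "B \<in> BA"
proof -
  interpret B: normed_algebra B by fact
  have "\<exists>x. tends_to B y x" if y: "is_cauchy B y" for y
  proof -
    have yc: "y n \<in> acarrier B" for n using y by (rule is_cauchy_closed)
    then have "y n \<in> atopology B closure_of S" for n using assms(3) by blast
    then have "\<exists>x\<in>S. anorm B (adiff B x (y n)) < inverse (real (Suc n))" for n
      unfolding B.closure_of_iff[OF assms(2)] by (metis inverse_positive_iff_positive of_nat_0_less_iff zero_less_Suc)
    then obtain s where s: "\<And>n. s n \<in> S"
      "\<And>n. anorm B (adiff B (s n) (y n)) < inverse (real (Suc n))"
      by metis
    have sc: "s n \<in> acarrier B" for n using s assms(2) by blast
    have "is_cauchy B s"
      by (rule B.is_cauchy_perturb[OF y sc _ LIMSEQ_inverse_real_of_nat]) (rule less_imp_le[OF s(2)])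
    then obtain x where x: "tends_to B s x" using lim s by blast
    have "tends_to B y x"
      by (rule B.tends_to_perturb[OF x yc _ LIMSEQ_inverse_real_of_nat])
        (metis B.dist_commute[OF yc sc] less_imp_le[OF s(2)])
    then show ?thesis ..
  qed
  then show ?thesis using assms(1) by (simp add: BA_iff)
qed

text \<open>
  Cauchy sequences under pointwise operations, modulo null sequences.  They fit into the universe
  because it absorbs its own sequences.
\<close>

lemma ex_completion:
  fixes A :: "'a::sequence_closed nalg"
  assumes "normed_algebra A"
  shows "\<exists>B \<iota>. is_completion A B \<iota>"
proof -
  interpret A: normed_algebra A by fact
  let ?D = "cauchy_alg A"
  obtain e :: "(nat \<Rightarrow> 'a) \<Rightarrow> 'a" where "inj e" using ex_inj_seq by blast
  have D: "seminormed_algebra ?D"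
    by (rule seminormed_cauchy_alg) (rule A.seminormed_algebra_axioms)
  interpret D: seminormed_algebra ?D by (rule D)
  obtain B :: "'a nalg" and \<phi> where B: "normed_algebra B"
    and carrier: "acarrier B = \<phi> ` acarrier ?D"
    and add: "\<And>x y. \<lbrakk>x \<in> acarrier ?D; y \<in> acarrier ?D\<rbrakk> \<Longrightarrow> aadd B (\<phi> x) (\<phi> y) = \<phi> (aadd ?D x y)"
    and mult: "\<And>x y. \<lbrakk>x \<in> acarrier ?D; y \<in> acarrier ?D\<rbrakk> \<Longrightarrow> amult B (\<phi> x) (\<phi> y) = \<phi> (amult ?D x y)"
    and scale: "\<And>c x. x \<in> acarrier ?D \<Longrightarrow> ascale B c (\<phi> x) = \<phi> (ascale ?D c x)"
    and norm: "\<And>x. x \<in> acarrier ?D \<Longrightarrow> anorm B (\<phi> x) = anorm ?D x"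
    using ex_hausdorff_quotient[OF D \<open>inj e\<close>] by blast
  interpret B: normed_algebra B by (rule B)
  define \<iota> where "\<iota> x = \<phi> (\<lambda>n::nat. x)" for x
  have const: "(\<lambda>n. x) \<in> acarrier ?D" if "x \<in> acarrier A" for x
    using A.tends_to_imp_cauchy[OF A.tends_to_const[OF that]] by (simp add: cauchy_alg_def)
  have hom: "alg_hom A B \<iota>"
    using const unfolding alg_hom_def \<iota>_def carrier
    by (auto simp: add mult scale) (simp_all add: cauchy_alg_def)
  have iso: "anorm B (\<iota> x) = anorm A x" if "x \<in> acarrier A" for x
    using const[OF that] by (simp add: \<iota>_def norm) (simp add: cauchy_alg_def)
  have dist: "anorm B (adiff B (\<iota> x) (\<iota> y)) = anorm A (adiff A x y)"
    if "x \<in> acarrier A" "y \<in> acarrier A" for x y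
    using that by (simp add: iso A.closed flip: alg_hom_diff[OF assms hom])
  \<comment> \<open>The class of a Cauchy sequence is the limit of the constants given by its terms.\<close>
  have lim: "tends_to B (\<lambda>n. \<iota> (s n)) (\<phi> s)" if s: "is_cauchy A s" for s
  proof -
    have sD: "s \<in> acarrier ?D" using s by (simp add: cauchy_alg_def)
    have sA: "s n \<in> acarrier A" for n using s by (rule is_cauchy_closed)
    have close: "anorm B (adiff B (\<iota> (s n)) (\<phi> s)) = lim (\<lambda>m. anorm A (adiff A (s n) (s m)))" for n
    proof -
      have "adiff B (\<iota> (s n)) (\<phi> s) = \<phi> (adiff ?D (\<lambda>m. s n) s)"
        using const[OF sA] sD unfolding adiff_def \<iota>_def by (simp add: add scale D.closed)
      then show ?thesis
        using const[OF sA] sD by (simp add: norm D.closed) (simp add: cauchy_alg_def adiff_def)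
    qed
    have conv: "(\<lambda>m. anorm A (adiff A (s n) (s m))) \<longlonglongrightarrow> anorm B (adiff B (\<iota> (s n)) (\<phi> s))" for n
    proof -
      have "is_cauchy A (\<lambda>m. adiff A (s n) (s m))"
        unfolding adiff_def using const[OF sA] s
        by (intro A.is_cauchy_add A.is_cauchy_scale) (auto simp: cauchy_alg_def)
      then show ?thesis
        using A.is_cauchy_norm_convergent by (simp add: close convergent_LIMSEQ_iff)
    qed
    have "(\<lambda>n. anorm B (adiff B (\<iota> (s n)) (\<phi> s))) \<longlonglongrightarrow> 0"
    proof (rule LIMSEQ_I)
      fix e :: real assume "e > 0"
      then obtain N where N: "\<And>m n. \<lbrakk>m \<ge> N; n \<ge> N\<rbrakk> \<Longrightarrow> anorm A (adiff A (s m) (s n)) < e / 2"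
        using s unfolding is_cauchy_def by (meson half_gt_zero)
      have "anorm B (adiff B (\<iota> (s n)) (\<phi> s)) \<le> e / 2" if "n \<ge> N" for n
        by (rule LIMSEQ_le_const2[OF conv]) (use N that in \<open>auto intro!: exI[of _ N] less_imp_le\<close>)
      moreover have "anorm B (adiff B (\<iota> (s n)) (\<phi> s)) \<ge> 0" for n
        using sA sD alg_homD(1)[OF hom] carrier by (intro B.norm_nonneg B.closed) auto
      ultimately show "\<exists>N. \<forall>n\<ge>N. norm (anorm B (adiff B (\<iota> (s n)) (\<phi> s)) - 0) < e"
        using \<open>e > 0\<close> by (intro exI[of _ N]) fastforce
    qed
    then show ?thesis
      using alg_homD(1)[OF hom] sA sD carrier by (auto simp: tends_to_def)
  qed
  have sub: "\<iota> ` acarrier A \<subseteq> acarrier B"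
    using alg_homD(1)[OF hom] by blast
  have dense: "atopology B closure_of (\<iota> ` acarrier A) = acarrier B"
  proof
    show "atopology B closure_of (\<iota> ` acarrier A) \<subseteq> acarrier B"
      using B.closure_of_iff[OF sub] by blast
    show "acarrier B \<subseteq> atopology B closure_of (\<iota> ` acarrier A)"
    proof
      fix y assume "y \<in> acarrier B"
      then obtain s where "is_cauchy A s" "y = \<phi> s"
        by (auto simp: carrier cauchy_alg_def)
      then show "y \<in> atopology B closure_of (\<iota> ` acarrier A)"
        unfolding B.closure_of_iff_tends_to[OF sub] using lim is_cauchy_closed
        by (intro exI[of _ "\<lambda>n. \<iota> (s n)"]) blast
    qed
  qed
  have "B \<in> BA"
  proof (rule complete_if_dense[OF B sub dense])
    fix y assume y: "range y \<subseteq> \<iota> ` acarrier A" "is_cauchy B y"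
    then have "\<forall>n. \<exists>x. x \<in> acarrier A \<and> y n = \<iota> x" by blast
    then obtain s where s: "\<And>n. s n \<in> acarrier A" "\<And>n. y n = \<iota> (s n)" by metis
    have "is_cauchy A s"
      by (rule is_cauchy_dominated[where K = 1, OF y(2) assms]) (simp_all add: s dist)
    then show "\<exists>x. tends_to B y x" using lim s(2) by (metis ext)
  qed
  then show ?thesis
    unfolding is_completion_def using hom iso dense by blast
qed

section \<open>Uniqueness of topological completions\<close>

text \<open>
  Compared with \<^const>\<open>is_completion\<close>, the embedding is only required to be a homeomorphism onto its
  image.  Such embeddings arise by composing a completion with a topological isomorphism.
\<close>

definition dense_embedding :: "'a nalg \<Rightarrow> 'a nalg \<Rightarrow> ('a \<Rightarrow> 'a) \<Rightarrow> bool"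
  where "dense_embedding A C j \<longleftrightarrow>
    C \<in> BA \<and> alg_hom A C j \<and>
    (\<exists>c>0. \<exists>M>0. \<forall>x\<in>acarrier A. c * anorm A x \<le> anorm C (j x) \<and> anorm C (j x) \<le> M * anorm A x) \<and>
    atopology C closure_of (j ` acarrier A) = acarrier C"

lemma dense_embeddingE:
  assumes "dense_embedding A C j"
  obtains c M where "C \<in> BA" "normed_algebra C" "alg_hom A C j" "c > 0" "M > 0"
    "\<And>x. x \<in> acarrier A \<Longrightarrow> c * anorm A x \<le> anorm C (j x)"
    "\<And>x. x \<in> acarrier A \<Longrightarrow> anorm C (j x) \<le> M * anorm A x"
    "\<And>y. y \<in> acarrier C \<Longrightarrow> \<exists>s. (\<forall>n. s n \<in> acarrier A) \<and> tends_to C (\<lambda>n. j (s n)) y"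
proof -
  have C: "C \<in> BA" "normed_algebra C" and hom: "alg_hom A C j"
    using assms by (auto simp: dense_embedding_def BA_def)
  interpret C: normed_algebra C by fact
  have seq: "\<exists>s. (\<forall>n. s n \<in> acarrier A) \<and> tends_to C (\<lambda>n. j (s n)) y" if y: "y \<in> acarrier C" for y
  proof -
    have sub: "j ` acarrier A \<subseteq> acarrier C" using alg_homD(1)[OF hom] by blast
    have "y \<in> atopology C closure_of (j ` acarrier A)"
      using assms y by (simp add: dense_embedding_def)
    then obtain t where t: "range t \<subseteq> j ` acarrier A" "tends_to C t y"
      unfolding C.closure_of_iff_tends_to[OF sub] by blast
    then have "\<forall>n. \<exists>x. x \<in> acarrier A \<and> t n = j x" by blast
    then obtain s where s: "\<And>n. s n \<in> acarrier A" "\<And>n. t n = j (s n)" by metis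
    then have "t = (\<lambda>n. j (s n))" by blast
    then show ?thesis using s(1) t(2) by blast
  qed
  show thesis
    using assms that[OF C hom _ _ _ _ seq] unfolding dense_embedding_def by blast
qed

text \<open>
  The isomorphism sends \<open>lim j1 (s n)\<close> to \<open>lim j2 (s n)\<close>.  As a relation between \<open>C1\<close> and \<open>C2\<close> this is
  symmetric in the two embeddings and compatible with the operations; the norm estimates make it
  single-valued and bounded, and completeness makes it total, in both directions.
\<close>

lemma dense_embedding_unique:
  assumes "normed_algebra A" "dense_embedding A C1 j1" "dense_embedding A C2 j2"
  obtains g where "topological_iso C1 C2 g" "\<And>x. x \<in> acarrier A \<Longrightarrow> g (j1 x) = j2 x"
proof -
  interpret A: normed_algebra A by fact
  define rel where "rel C j D k y z \<longleftrightarrow> (\<exists>s. (\<forall>n. s n \<in> acarrier A) \<and>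
      tends_to C (\<lambda>n. j (s n)) y \<and> tends_to D (\<lambda>n. k (s n)) z)"
    for C D :: "'a nalg" and j k y z
  have rel_swap: "rel C j D k y z \<longleftrightarrow> rel D k C j z y" for C D j k y z
    unfolding rel_def by blast
  have total: "\<exists>z. rel C j D k y z"
    and bounded: "\<exists>K>0. \<forall>y z. rel C j D k y z \<longrightarrow> anorm D z \<le> K * anorm C y"
    if emb: "dense_embedding A C j" "dense_embedding A D k" and y: "y \<in> acarrier C"
    for C D j k y
  proof -
    obtain c where C: "normed_algebra C" "alg_hom A C j" and c: "c > 0"
      "\<And>x. x \<in> acarrier A \<Longrightarrow> c * anorm A x \<le> anorm C (j x)"
      and seq: "\<And>y. y \<in> acarrier C \<Longrightarrow> \<exists>s. (\<forall>n. s n \<in> acarrier A) \<and> tends_to C (\<lambda>n. j (s n)) y"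
      using emb(1) by (rule dense_embeddingE) blast
    obtain M where D: "D \<in> BA" "normed_algebra D" "alg_hom A D k" and M: "M > 0"
      "\<And>x. x \<in> acarrier A \<Longrightarrow> anorm D (k x) \<le> M * anorm A x"
      using emb(2) by (rule dense_embeddingE) blast
    interpret C: normed_algebra C by fact
    interpret D: normed_algebra D by fact
    have le: "anorm D (k x) \<le> M / c * anorm C (j x)" if "x \<in> acarrier A" for x
    proof -
      have "anorm D (k x) \<le> M * anorm A x" using M(2) that .
      also have "\<dots> \<le> M * (anorm C (j x) / c)"
        using c(2)[OF that] c(1) M(1) by (intro mult_left_mono) (simp_all add: field_simps)
      finally show ?thesis by simp
    qed
    obtain s where s: "\<And>n. s n \<in> acarrier A" "tends_to C (\<lambda>n. j (s n)) y"
      using seq[OF y] by blast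
    have "is_cauchy D (\<lambda>n. k (s n))"
    proof (rule is_cauchy_dominated[where K = "M / c", OF C.tends_to_imp_cauchy[OF s(2)] D(2)])
      show "anorm D (adiff D (k (s m)) (k (s n))) \<le> M / c * anorm C (adiff C (j (s m)) (j (s n)))"
        for m n
        using le[of "adiff A (s m) (s n)"] s(1)
        by (simp add: A.closed alg_hom_diff[OF assms(1) C(2)] alg_hom_diff[OF assms(1) D(3)])
    qed (use s(1) alg_homD(1)[OF D(3)] c(1) M(1) in auto)
    then show "\<exists>z. rel C j D k y z"
      using s D(1) unfolding BA_iff rel_def by blast
    have "anorm D z \<le> M / c * anorm C y" if yz: "rel C j D k y z" for y z
    proof -
      obtain s where "\<forall>n. s n \<in> acarrier A" "tends_to C (\<lambda>n. j (s n)) y" "tends_to D (\<lambda>n. k (s n)) z"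
        using yz unfolding rel_def by blast
      then show ?thesis
        using le by (intro LIMSEQ_le[OF D.tends_to_norm tendsto_mult_left[OF C.tends_to_norm]]) auto
    qed
    then show "\<exists>K>0. \<forall>y z. rel C j D k y z \<longrightarrow> anorm D z \<le> K * anorm C y"
      using M(1) c(1) by (intro exI[of _ "M / c"]) simp
  qed
  have C1: "normed_algebra C1" "alg_hom A C1 j1"
    using assms(2) by (auto simp: dense_embedding_def BA_def)
  have C2: "normed_algebra C2" "alg_hom A C2 j2"
    using assms(3) by (auto simp: dense_embedding_def BA_def)
  interpret C1: normed_algebra C1 by (rule C1)
  interpret C2: normed_algebra C2 by (rule C2)
  let ?rel = "rel C1 j1 C2 j2"
  have closed: "y \<in> acarrier C1" "z \<in> acarrier C2" if "?rel y z" for y z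
    using that unfolding rel_def tends_to_def by blast+
  have add: "?rel (aadd C1 y y') (aadd C2 z z')" and mult: "?rel (amult C1 y y') (amult C2 z z')"
    if rels: "?rel y z" "?rel y' z'" for y z y' z'
  proof -
    obtain s t
      where s: "\<forall>n. s n \<in> acarrier A" "tends_to C1 (\<lambda>n. j1 (s n)) y" "tends_to C2 (\<lambda>n. j2 (s n)) z"
        and t: "\<forall>n. t n \<in> acarrier A" "tends_to C1 (\<lambda>n. j1 (t n)) y'" "tends_to C2 (\<lambda>n. j2 (t n)) z'"
      using rels unfolding rel_def by blast
    show "?rel (aadd C1 y y') (aadd C2 z z')"
      unfolding rel_def
      using s t C1.tends_to_add[OF s(2) t(2)] C2.tends_to_add[OF s(3) t(3)]
      by (intro exI[of _ "\<lambda>n. aadd A (s n) (t n)"])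
        (simp add: A.closed alg_homD[OF C1(2)] alg_homD[OF C2(2)])
    show "?rel (amult C1 y y') (amult C2 z z')"
      unfolding rel_def
      using s t C1.tends_to_mult[OF s(2) t(2)] C2.tends_to_mult[OF s(3) t(3)]
      by (intro exI[of _ "\<lambda>n. amult A (s n) (t n)"])
        (simp add: A.closed alg_homD[OF C1(2)] alg_homD[OF C2(2)])
  qed
  have scale: "?rel (ascale C1 c y) (ascale C2 c z)" if yz: "?rel y z" for c y z
  proof -
    obtain s where s: "\<forall>n. s n \<in> acarrier A"
      "tends_to C1 (\<lambda>n. j1 (s n)) y" "tends_to C2 (\<lambda>n. j2 (s n)) z"
      using yz unfolding rel_def by blast
    show ?thesis
      unfolding rel_def
      using s C1.tends_to_scale[OF s(2)] C2.tends_to_scale[OF s(3)]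
      by (intro exI[of _ "\<lambda>n. ascale A c (s n)"])
        (simp add: A.closed alg_homD[OF C1(2)] alg_homD[OF C2(2)])
  qed
  have diff: "?rel (adiff C1 y y') (adiff C2 z z')" if "?rel y z" "?rel y' z'" for y z y' z'
    unfolding adiff_def using that by (intro add scale)
  obtain K where K: "K > 0" "\<And>y z. ?rel y z \<Longrightarrow> anorm C2 z \<le> K * anorm C1 y"
    using bounded[OF assms(2,3) C1.zero_closed] by blast
  obtain L where L: "L > 0" "\<And>y z. ?rel y z \<Longrightarrow> anorm C1 y \<le> L * anorm C2 z"
    using bounded[OF assms(3,2) C2.zero_closed] rel_swap by metis
  have fun1: "z = z'" if "?rel y z" "?rel y z'" for y z z'
  proof -
    have "anorm C2 (adiff C2 z z') \<le> K * anorm C1 (adiff C1 y y)"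
      by (rule K(2)[OF diff[OF that]])
    then have "anorm C2 (adiff C2 z z') = 0"
      using closed[OF that(1)] closed[OF that(2)] C2.norm_nonneg[of "adiff C2 z z'"]
      by (simp add: C1.diff_self C1.norm_zero C2.closed)
    then show ?thesis
      using closed[OF that(1)] closed[OF that(2)]
      by (simp add: C2.norm_eq_zero C2.closed C2.diff_eq_zero_iff)
  qed
  have fun2: "y = y'" if "?rel y z" "?rel y' z" for y y' z
  proof -
    have "anorm C1 (adiff C1 y y') \<le> L * anorm C2 (adiff C2 z z)"
      by (rule L(2)[OF diff[OF that]])
    then have "anorm C1 (adiff C1 y y') = 0"
      using closed[OF that(1)] closed[OF that(2)] C1.norm_nonneg[of "adiff C1 y y'"]
      by (simp add: C2.diff_self C2.norm_zero C1.closed)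
    then show ?thesis
      using closed[OF that(1)] closed[OF that(2)]
      by (simp add: C1.norm_eq_zero C1.closed C1.diff_eq_zero_iff)
  qed
  define g where "g y = (SOME z. ?rel y z)" for y
  have g: "?rel y (g y)" if "y \<in> acarrier C1" for y
    unfolding g_def using total[OF assms(2,3) that] by (rule someI_ex)
  have g_eq: "g y = z" if "?rel y z" for y z
    using fun1[OF g[OF closed(1)[OF that]] that] .
  have hom: "alg_hom C1 C2 g"
    unfolding alg_hom_def using g closed(2) by (auto intro!: g_eq add mult scale)
  moreover have "bij_betw g (acarrier C1) (acarrier C2)"
    unfolding bij_betw_def
  proof
    show "inj_on g (acarrier C1)"
      using g fun2 by (metis inj_onI)
    show "g ` acarrier C1 = acarrier C2"
    proof
      show "acarrier C2 \<subseteq> g ` acarrier C1"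
      proof
        fix z assume "z \<in> acarrier C2"
        then obtain y where "?rel y z"
          using total[OF assms(3,2)] rel_swap by metis
        then show "z \<in> g ` acarrier C1"
          using g_eq closed(1) by blast
      qed
    qed (use closed(2)[OF g] in blast)
  qed
  moreover have "inverse L * anorm C1 y \<le> anorm C2 (g y)" "anorm C2 (g y) \<le> K * anorm C1 y"
    if "y \<in> acarrier C1" for y
    using K(2)[OF g[OF that]] L(2)[OF g[OF that]] L(1) by (simp_all add: field_simps)
  ultimately have "topological_iso C1 C2 g"
    unfolding topological_iso_iff[OF C1(1) C2(1)]
    using K(1) positive_imp_inverse_positive[OF L(1)] by blast
  moreover have "g (j1 x) = j2 x" if "x \<in> acarrier A" for x
    using that alg_homD(1)[OF C1(2)] alg_homD(1)[OF C2(2)] unfolding rel_def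
    by (intro g_eq) (auto simp: rel_def intro!: exI[of _ "\<lambda>n. x"] C1.tends_to_const C2.tends_to_const)
  ultimately show thesis by (rule that)
qed

section \<open>Ideals\<close>

lemma sub_alg_simps [simp]:
  "acarrier (sub_alg A I) = I" "aadd (sub_alg A I) = aadd A" "amult (sub_alg A I) = amult A"
  "azero (sub_alg A I) = azero A" "ascale (sub_alg A I) = ascale A" "anorm (sub_alg A I) = anorm A"
  "adiff (sub_alg A I) = adiff A"
  by (simp_all add: sub_alg_def adiff_def fun_eq_iff)

lemma alg_idealD:
  assumes "alg_ideal A I"
  shows "I \<subseteq> acarrier A" "azero A \<in> I"
    and "\<lbrakk>x \<in> I; y \<in> I\<rbrakk> \<Longrightarrow> aadd A x y \<in> I"
    and "x \<in> I \<Longrightarrow> ascale A c x \<in> I"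
    and "\<lbrakk>x \<in> I; y \<in> I\<rbrakk> \<Longrightarrow> adiff A x y \<in> I"
    and "\<lbrakk>a \<in> acarrier A; x \<in> I\<rbrakk> \<Longrightarrow> amult A a x \<in> I"
    and "\<lbrakk>a \<in> acarrier A; x \<in> I\<rbrakk> \<Longrightarrow> amult A x a \<in> I"
    and "x \<in> I \<Longrightarrow> x \<in> acarrier A"
  using assms by (auto simp: alg_ideal_def adiff_def)

lemma normed_algebra_sub_alg:
  assumes "normed_algebra A" "alg_ideal A I"
  shows "normed_algebra (sub_alg A I)"
proof -
  interpret A: normed_algebra A by fact
  note I = alg_idealD[OF assms(2)]
  show ?thesis
  proof
    show "aadd (sub_alg A I) x y = aadd (sub_alg A I) y x"
      if "x \<in> acarrier (sub_alg A I)" "y \<in> acarrier (sub_alg A I)" for x y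
      using that I(8) A.add_commute by simp
  qed (auto simp: I A.add_assoc A.mult_assoc A.add_zero A.add_neg
      A.scale_add_right A.scale_add_left A.scale_scale A.scale_one A.mult_add_left A.mult_add_right
      A.mult_scale_left A.mult_scale_right A.norm_triangle A.norm_scale A.norm_mult A.norm_eq_zero)
qed

lemma tends_to_sub_alg:
  assumes "I \<subseteq> acarrier A"
  shows "tends_to (sub_alg A I) s x \<longleftrightarrow> range s \<subseteq> I \<and> x \<in> I \<and> tends_to A s x"
  using assms by (auto simp: tends_to_def)

lemma is_cauchy_sub_alg:
  assumes "I \<subseteq> acarrier A"
  shows "is_cauchy (sub_alg A I) s \<longleftrightarrow> range s \<subseteq> I \<and> is_cauchy A s"
  using assms by (auto simp: is_cauchy_def)

lemma sub_alg_BA: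
  assumes "A \<in> BA" "closed_ideal A I"
  shows "sub_alg A I \<in> BA"
proof -
  have A: "normed_algebra A" and I: "alg_ideal A I" "closedin (atopology A) I"
    using assms by (auto simp: BA_def closed_ideal_def)
  note sub = alg_idealD(1)[OF I(1)]
  have "\<exists>x. tends_to (sub_alg A I) s x" if "is_cauchy (sub_alg A I) s" for s
  proof -
    have s: "range s \<subseteq> I" "is_cauchy A s"
      using that by (simp_all add: is_cauchy_sub_alg[OF sub])
    then obtain x where "tends_to A s x"
      using assms(1) unfolding BA_iff by blast
    moreover from this have "x \<in> I"
      using normed_algebra.closedin_tends_toD[OF A I(2)] s(1) by blast
    ultimately show ?thesis
      using s(1) by (auto simp: tends_to_sub_alg[OF sub])
  qed
  then show ?thesis
    unfolding BA_iff using normed_algebra_sub_alg[OF A I(1)] by blast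
qed

lemma closed_ideal_vimage:
  assumes "normed_algebra A" "normed_algebra B" "alg_hom A B f" "closed_ideal B L"
    and bound: "\<And>x. x \<in> acarrier A \<Longrightarrow> anorm B (f x) \<le> M * anorm A x"
  shows "closed_ideal A {x \<in> acarrier A. f x \<in> L}"
proof -
  interpret A: normed_algebra A by fact
  interpret B: normed_algebra B by fact
  have L: "alg_ideal B L" "closedin (atopology B) L"
    using assms(4) by (auto simp: closed_ideal_def)
  note hom = alg_homD[OF assms(3)]
  have ideal: "alg_ideal A {x \<in> acarrier A. f x \<in> L}"
    unfolding alg_ideal_def
    by (simp add: A.closed hom alg_idealD(2-4,6,7)[OF L(1)] alg_hom_zero[OF assms(1-3)] subset_iff)
  have "f x \<in> L" if s: "\<And>n. f (s n) \<in> L" "tends_to A s x" for s x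
  proof -
    have "tends_to B (\<lambda>n. f (s n)) (f x)"
    proof (rule B.tends_toI)
      show "(\<lambda>n. M * anorm A (adiff A (s n) x)) \<longlonglongrightarrow> 0"
        using tendsto_mult_left[OF tends_toD(3)[OF s(2)]] by simp
      show "anorm B (adiff B (f (s n)) (f x)) \<le> M * anorm A (adiff A (s n) x)" for n
        using bound[of "adiff A (s n) x"] tends_toD(1,2)[OF s(2)]
        by (simp add: alg_hom_diff[OF assms(1,3)] A.closed)
    qed (use tends_toD(1,2)[OF s(2)] hom(1) in auto)
    then show ?thesis
      by (rule B.closedin_tends_toD[OF L(2) s(1)])
  qed
  then have "closedin (atopology A) {x \<in> acarrier A. f x \<in> L}"
    unfolding A.closedin_iff_tends_to using tends_toD(2) by (fastforce simp: image_subset_iff)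
  with ideal show ?thesis by (simp add: closed_ideal_def)
qed

text \<open>
  An element of \<open>C\<close> is the limit of elements \<open>j a\<close>, so its products with elements of the closure are
  limits of elements \<open>j (a i)\<close> and \<open>j (i a)\<close>.
\<close>

lemma closed_ideal_closure_image:
  assumes "dense_embedding A C j" "alg_ideal A I" "normed_algebra A"
  shows "closed_ideal C (atopology C closure_of (j ` I))"
proof -
  obtain C: "normed_algebra C" and hom: "alg_hom A C j"
    and dense: "\<And>y. y \<in> acarrier C \<Longrightarrow> \<exists>s. (\<forall>n. s n \<in> acarrier A) \<and> tends_to C (\<lambda>n. j (s n)) y"
    using assms(1) by (rule dense_embeddingE) blast
  interpret C: normed_algebra C by (rule C)
  note I = alg_idealD[OF assms(2)]
  have sub: "j ` I \<subseteq> acarrier C"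
    using I(8) alg_homD(1)[OF hom] by blast
  have mem: "x \<in> atopology C closure_of (j ` I) \<longleftrightarrow>
    (\<exists>s. (\<forall>n. s n \<in> I) \<and> tends_to C (\<lambda>n. j (s n)) x)" for x
  proof -
    have eq: "range t \<subseteq> j ` I \<longleftrightarrow> (\<exists>s. (\<forall>n. s n \<in> I) \<and> t = (\<lambda>n. j (s n)))" for t
    proof
      assume "range t \<subseteq> j ` I"
      then have "\<forall>n. \<exists>i. i \<in> I \<and> t n = j i" by blast
      then obtain s where "\<forall>n. s n \<in> I \<and> t n = j (s n)" by (rule choice[THEN exE])
      then show "\<exists>s. (\<forall>n. s n \<in> I) \<and> t = (\<lambda>n. j (s n))" by (auto intro: exI[of _ s])
    qed auto
    show ?thesis
      unfolding C.closure_of_iff_tends_to[OF sub] eq by auto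
  qed
  have "alg_ideal C (atopology C closure_of (j ` I))" (is "alg_ideal C ?K")
    unfolding alg_ideal_def
  proof (intro conjI ballI allI)
    show "?K \<subseteq> acarrier C"
      by (metis C.topspace_atopology closure_of_subset_topspace)
    show "azero C \<in> ?K"
      unfolding mem using I(2) alg_hom_zero[OF assms(3) C hom] C.tends_to_const[OF C.zero_closed]
      by (intro exI[of _ "\<lambda>n. azero A"]) simp
    fix x assume "x \<in> ?K"
    then obtain s where s: "\<forall>n. s n \<in> I" "tends_to C (\<lambda>n. j (s n)) x"
      using mem by blast
    show "ascale C c x \<in> ?K" for c
      unfolding mem using s C.tends_to_scale[OF s(2), of c]
      by (intro exI[of _ "\<lambda>n. ascale A c (s n)"]) (simp add: I(2-8) alg_homD[OF hom])
    show "aadd C x y \<in> ?K" if y: "y \<in> ?K" for y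
    proof -
      obtain t where t: "\<forall>n. t n \<in> I" "tends_to C (\<lambda>n. j (t n)) y"
        using y mem by blast
      then show ?thesis
        unfolding mem using s C.tends_to_add[OF s(2) t(2)]
        by (intro exI[of _ "\<lambda>n. aadd A (s n) (t n)"]) (simp add: I(2-8) alg_homD[OF hom])
    qed
    fix a assume "a \<in> acarrier C"
    then obtain t where t: "\<forall>n. t n \<in> acarrier A" "tends_to C (\<lambda>n. j (t n)) a"
      using dense by blast
    show "amult C a x \<in> ?K"
      unfolding mem using s t C.tends_to_mult[OF t(2) s(2)]
      by (intro exI[of _ "\<lambda>n. amult A (t n) (s n)"]) (simp add: I(2-8) alg_homD[OF hom])
    show "amult C x a \<in> ?K"
      unfolding mem using s t C.tends_to_mult[OF s(2) t(2)]
      by (intro exI[of _ "\<lambda>n. amult A (s n) (t n)"]) (simp add: I(2-8) alg_homD[OF hom])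
  qed
  then show ?thesis by (simp add: closed_ideal_def)
qed

lemma dense_embedding_ideal:
  assumes "dense_embedding A C j" "alg_ideal A I" "normed_algebra A"
  shows "dense_embedding (sub_alg A I) (sub_alg C (atopology C closure_of (j ` I))) j"
    (is "dense_embedding _ (sub_alg C ?K) j")
proof -
  obtain c M where C: "C \<in> BA" "normed_algebra C" and hom: "alg_hom A C j"
    and bounds: "c > 0" "M > 0" "\<And>x. x \<in> acarrier A \<Longrightarrow> c * anorm A x \<le> anorm C (j x)"
      "\<And>x. x \<in> acarrier A \<Longrightarrow> anorm C (j x) \<le> M * anorm A x"
    using assms(1) by (rule dense_embeddingE) blast
  interpret C: normed_algebra C by (rule C)
  note I = alg_idealD[OF assms(2)]
  have K: "closed_ideal C ?K"
    using assms by (rule closed_ideal_closure_image)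
  then have Ki: "alg_ideal C ?K" by (simp add: closed_ideal_def)
  have sub: "j ` I \<subseteq> acarrier C"
    using I(8) alg_homD(1)[OF hom] by blast
  have subK: "j ` I \<subseteq> ?K"
    using sub by (intro closure_of_subset) (simp add: C.topspace_atopology)
  have KB: "sub_alg C ?K \<in> BA" using C(1) K by (rule sub_alg_BA)
  then interpret K: normed_algebra "sub_alg C ?K" by (simp add: BA_def)
  have "x \<in> atopology (sub_alg C ?K) closure_of (j ` I) \<longleftrightarrow> x \<in> ?K" for x
  proof -
    have "range s \<subseteq> j ` I \<and> tends_to (sub_alg C ?K) s x \<longleftrightarrow> range s \<subseteq> j ` I \<and> tends_to C s x" for s
      unfolding tends_to_sub_alg[OF alg_idealD(1)[OF Ki]]
      using order_trans[OF _ subK, of "range s"] C.closure_of_iff_tends_to[OF sub, of x] by blast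
    then show ?thesis
      using subK by (simp add: K.closure_of_iff_tends_to C.closure_of_iff_tends_to[OF sub, of x])
  qed
  then have "atopology (sub_alg C ?K) closure_of (j ` I) = ?K" by blast
  moreover have "alg_hom (sub_alg A I) (sub_alg C ?K) j"
    using hom I(8) subK unfolding alg_hom_def by auto
  ultimately show ?thesis
    unfolding dense_embedding_def sub_alg_simps using KB bounds I(8) by blast
qed

section \<open>Quotients\<close>

locale normed_algebra_ideal = normed_algebra A for A :: "'a nalg" +
  fixes I :: "'a set"
  assumes ideal: "alg_ideal A I"
begin

lemmas ideal_facts = alg_idealD[OF ideal]

lemma quot_map_in_coset: "\<exists>i\<in>I. quot_map A I x = aadd A x i"
proof -
  have "\<exists>y. y \<in> aadd A x ` I" using ideal_facts(2) by blast
  then have "quot_map A I x \<in> aadd A x ` I"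
    unfolding quot_map_def by (rule someI_ex)
  then show ?thesis by blast
qed

lemma quot_map_closed: "x \<in> acarrier A \<Longrightarrow> quot_map A I x \<in> acarrier A"
  using quot_map_in_coset[of x] ideal_facts(8) by (auto simp: closed)

lemma quot_map_diff: "x \<in> acarrier A \<Longrightarrow> adiff A (quot_map A I x) x \<in> I"
proof -
  assume x: "x \<in> acarrier A"
  obtain i where i: "i \<in> I" "quot_map A I x = aadd A x i" using quot_map_in_coset by blast
  have "adiff A (aadd A x i) (aadd A x (azero A)) = i"
    using x i ideal_facts(8) by (simp add: add_diff_add closed diff_self diff_zero zero_add)
  then show ?thesis using x i by (simp add: add_zero)
qed

lemma quot_map_eq_iff:
  assumes "x \<in> acarrier A" "y \<in> acarrier A"
  shows "quot_map A I x = quot_map A I y \<longleftrightarrow> adiff A x y \<in> I"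
proof
  assume eq: "quot_map A I x = quot_map A I y"
  have "aadd A (adiff A x (quot_map A I x)) (adiff A (quot_map A I x) y) \<in> I"
    using quot_map_diff[OF assms(1)] quot_map_diff[OF assms(2)] eq
      diff_swap[OF quot_map_closed[OF assms(1)] assms(1)] ideal_facts(3,4) by metis
  then show "adiff A x y \<in> I"
    using assms by (simp add: diff_trans quot_map_closed)
next
  assume d: "adiff A x y \<in> I"
  have sub: "aadd A x ` I \<subseteq> aadd A y ` I"
    if xy: "x \<in> acarrier A" "y \<in> acarrier A" "adiff A x y \<in> I" for x y
  proof
    fix z assume "z \<in> aadd A x ` I"
    then obtain i where i: "i \<in> I" "z = aadd A x i" by blast
    then have "z = aadd A y (aadd A (adiff A x y) i)"
      using xy ideal_facts(8) add_diff_cancel[OF xy(1,2)] by (simp add: closed flip: add_assoc)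
    then show "z \<in> aadd A y ` I" using i xy ideal_facts(3) by blast
  qed
  have "adiff A y x \<in> I"
    using d diff_swap[OF assms] ideal_facts(4) by metis
  then have "aadd A x ` I = aadd A y ` I"
    using sub[OF assms d] sub[OF assms(2,1)] by blast
  then show "quot_map A I x = quot_map A I y" by (simp add: quot_map_def)
qed

lemma quot_map_eq_zero_iff:
  "x \<in> acarrier A \<Longrightarrow> quot_map A I x = azero (quot_alg A I) \<longleftrightarrow> x \<in> I"
  using quot_map_eq_iff[OF _ zero_closed] by (simp add: quot_alg_def diff_zero)

lemma quot_map_idem: "x \<in> acarrier A \<Longrightarrow> quot_map A I (quot_map A I x) = quot_map A I x"
  by (simp add: quot_map_eq_iff quot_map_closed quot_map_diff)

lemma quot_map_add:
  "\<lbrakk>x \<in> acarrier A; y \<in> acarrier A\<rbrakk>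
    \<Longrightarrow> aadd (quot_alg A I) (quot_map A I x) (quot_map A I y) = quot_map A I (aadd A x y)"
  by (simp add: quot_alg_def quot_map_eq_iff quot_map_closed closed add_diff_add ideal_facts
      quot_map_diff)

lemma quot_map_mult:
  "\<lbrakk>x \<in> acarrier A; y \<in> acarrier A\<rbrakk>
    \<Longrightarrow> amult (quot_alg A I) (quot_map A I x) (quot_map A I y) = quot_map A I (amult A x y)"
  by (simp add: quot_alg_def quot_map_eq_iff quot_map_closed closed mult_diff_mult ideal_facts
      quot_map_diff)

lemma quot_map_scale:
  "x \<in> acarrier A \<Longrightarrow> ascale (quot_alg A I) c (quot_map A I x) = quot_map A I (ascale A c x)"
  by (simp add: quot_alg_def quot_map_eq_iff quot_map_closed closed scale_diff ideal_facts
      quot_map_diff)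

lemma alg_hom_quot_map: "alg_hom A (quot_alg A I) (quot_map A I)"
  unfolding alg_hom_def by (simp add: quot_map_add quot_map_mult quot_map_scale) (simp add: quot_alg_def)

lemma quot_carrier: "acarrier (quot_alg A I) = quot_map A I ` acarrier A"
  by (simp add: quot_alg_def)

text \<open>The quotient seminorm, that is, the distance from \<open>I\<close>.\<close>

abbreviation "qnorm \<equiv> anorm (quot_alg A I)"

lemma qnorm_bdd: "x \<in> acarrier A \<Longrightarrow> bdd_below ((\<lambda>i. anorm A (aadd A x i)) ` I)"
  using ideal_facts(8) by (intro bdd_belowI2[where m = 0] norm_nonneg closed)

lemma qnorm_le: "\<lbrakk>x \<in> acarrier A; i \<in> I\<rbrakk> \<Longrightarrow> qnorm x \<le> anorm A (aadd A x i)"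
  unfolding quot_alg_def using qnorm_bdd by (auto intro: cINF_lower)

lemma qnorm_le_norm: "x \<in> acarrier A \<Longrightarrow> qnorm x \<le> anorm A x"
  using qnorm_le[OF _ ideal_facts(2)] by (simp add: add_zero)

lemma qnorm_greatest: "(\<And>i. i \<in> I \<Longrightarrow> r \<le> anorm A (aadd A x i)) \<Longrightarrow> r \<le> qnorm x"
  unfolding quot_alg_def using ideal_facts(2) by (auto intro: cINF_greatest)

lemma qnorm_less: "qnorm x < r \<Longrightarrow> \<exists>i\<in>I. anorm A (aadd A x i) < r"
  using qnorm_greatest[of r x] by (meson linorder_not_less)

lemma qnorm_nonneg: "x \<in> acarrier A \<Longrightarrow> 0 \<le> qnorm x"
  using ideal_facts(8) by (intro qnorm_greatest norm_nonneg closed)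

lemma qnorm_ideal: "x \<in> I \<Longrightarrow> qnorm x = 0"
  using qnorm_le[of x "ascale A (-1) x"] qnorm_nonneg[of x] ideal_facts(4,8)
  by (simp add: add_neg norm_zero)

lemma qnorm_triangle:
  assumes x: "x \<in> acarrier A" and y: "y \<in> acarrier A"
  shows "qnorm (aadd A x y) \<le> qnorm x + qnorm y"
proof (rule field_le_epsilon)
  fix e :: real assume "e > 0"
  then obtain i k where i: "i \<in> I" "anorm A (aadd A x i) < qnorm x + e / 2"
    and k: "k \<in> I" "anorm A (aadd A y k) < qnorm y + e / 2"
    using qnorm_less[of x "qnorm x + e / 2"] qnorm_less[of y "qnorm y + e / 2"] by auto
  note cl = x y ideal_facts(8)[OF i(1)] ideal_facts(8)[OF k(1)]
  have "qnorm (aadd A x y) \<le> anorm A (aadd A (aadd A x y) (aadd A i k))"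
    using cl i k by (intro qnorm_le add_closed ideal_facts(3))
  also have "\<dots> = anorm A (aadd A (aadd A x i) (aadd A y k))"
    using cl by (simp add: closed add_ac)
  also have "\<dots> \<le> anorm A (aadd A x i) + anorm A (aadd A y k)"
    using cl by (intro norm_triangle closed)
  finally show "qnorm (aadd A x y) \<le> qnorm x + qnorm y + e"
    using i k by linarith
qed

lemma qnorm_add_ideal:
  assumes "x \<in> acarrier A" "i \<in> I" shows "qnorm (aadd A x i) = qnorm x"
proof (rule antisym)
  have i: "i \<in> acarrier A" using assms ideal_facts by blast
  show "qnorm (aadd A x i) \<le> qnorm x"
    using qnorm_triangle[OF assms(1) i] qnorm_ideal[OF assms(2)] by simp
  have "aadd A (aadd A x i) (ascale A (-1) i) = x"
    using assms(1) i by (simp add: add_assoc closed add_neg add_zero)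
  then show "qnorm x \<le> qnorm (aadd A x i)"
    using qnorm_triangle[of "aadd A x i" "ascale A (-1) i"] assms i
      qnorm_ideal[OF ideal_facts(4)[OF assms(2)]] by (simp add: closed)
qed

lemma qnorm_quot_map: "x \<in> acarrier A \<Longrightarrow> qnorm (quot_map A I x) = qnorm x"
  using quot_map_in_coset[of x] qnorm_add_ideal by auto

lemma qnorm_scale_le:
  assumes "x \<in> acarrier A" shows "qnorm (ascale A c x) \<le> cmod c * qnorm x"
proof (cases "c = 0")
  case True
  then show ?thesis
    using assms qnorm_ideal[OF ideal_facts(2)] by (simp add: scale_zero_left)
next
  case False
  have "qnorm (ascale A c x) / cmod c \<le> anorm A (aadd A x i)" if i: "i \<in> I" for i
  proof -
    have "qnorm (ascale A c x) \<le> anorm A (aadd A (ascale A c x) (ascale A c i))"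
      using assms i by (intro qnorm_le scale_closed ideal_facts(4))
    also have "\<dots> = cmod c * anorm A (aadd A x i)"
      using assms ideal_facts(8)[OF i] by (simp add: norm_scale closed flip: scale_add_right)
    finally show ?thesis using False by (simp add: divide_le_eq mult.commute)
  qed
  then have "qnorm (ascale A c x) / cmod c \<le> qnorm x"
    by (rule qnorm_greatest)
  then show ?thesis using False by (simp add: divide_le_eq mult.commute)
qed

lemma qnorm_scale:
  assumes "x \<in> acarrier A" shows "qnorm (ascale A c x) = cmod c * qnorm x"
proof (cases "c = 0")
  case True
  then show ?thesis
    using assms qnorm_ideal[OF ideal_facts(2)] by (simp add: scale_zero_left)
next
  case False
  have "qnorm (ascale A (inverse c) (ascale A c x)) \<le> cmod (inverse c) * qnorm (ascale A c x)"
    using assms by (intro qnorm_scale_le closed)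
  then have "cmod c * qnorm x \<le> qnorm (ascale A c x)"
    using assms False by (simp add: scale_scale scale_one norm_divide field_simps)
  then show ?thesis using qnorm_scale_le[OF assms, of c] by simp
qed

lemma qnorm_mult:
  assumes x: "x \<in> acarrier A" and y: "y \<in> acarrier A"
  shows "qnorm (amult A x y) \<le> qnorm x * qnorm y"
proof -
  have le: "qnorm (amult A x y) \<le> (qnorm x + e) * (qnorm y + e)" if "e > 0" for e
  proof -
    obtain i k where i: "i \<in> I" "anorm A (aadd A x i) < qnorm x + e"
      and k: "k \<in> I" "anorm A (aadd A y k) < qnorm y + e"
      using qnorm_less[of x "qnorm x + e"] qnorm_less[of y "qnorm y + e"] \<open>e > 0\<close> by auto
    note cl = x y ideal_facts(8)[OF i(1)] ideal_facts(8)[OF k(1)]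
    have "amult A (aadd A x i) (aadd A y k)
        = aadd A (amult A x y) (aadd A (amult A x k) (amult A i (aadd A y k)))"
      using cl by (simp add: mult_add_left[of x i "aadd A y k"] mult_add_right[of x y k] add_assoc closed)
    then have "qnorm (amult A x y) \<le> anorm A (amult A (aadd A x i) (aadd A y k))"
      using cl i k qnorm_le[of "amult A x y" "aadd A (amult A x k) (amult A i (aadd A y k))"]
      by (simp add: closed ideal_facts)
    also have "\<dots> \<le> anorm A (aadd A x i) * anorm A (aadd A y k)"
      using cl by (intro norm_mult closed)
    also have "\<dots> \<le> (qnorm x + e) * (qnorm y + e)"
      using i k cl qnorm_nonneg[OF x] \<open>e > 0\<close> by (intro mult_mono norm_nonneg closed) auto
    finally show ?thesis .
  qed
  have "(\<lambda>n. (qnorm x + inverse (real (Suc n))) * (qnorm y + inverse (real (Suc n))))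
      \<longlonglongrightarrow> (qnorm x + 0) * (qnorm y + 0)"
    by (intro tendsto_intros LIMSEQ_inverse_real_of_nat)
  moreover have "\<exists>N. \<forall>n\<ge>N. qnorm (amult A x y)
      \<le> (qnorm x + inverse (real (Suc n))) * (qnorm y + inverse (real (Suc n)))"
    using le by (intro exI[of _ 0]) auto
  ultimately have "qnorm (amult A x y) \<le> (qnorm x + 0) * (qnorm y + 0)"
    by (rule LIMSEQ_le_const)
  then show ?thesis by simp
qed

end

locale normed_algebra_closed_ideal = normed_algebra_ideal +
  assumes closed_ideal: "closedin (atopology A) I"
begin

lemma qnorm_eq_zero_imp:
  assumes x: "x \<in> acarrier A" and "qnorm x = 0"
  shows "x \<in> I"
proof -
  have "\<forall>n. \<exists>i\<in>I. anorm A (aadd A x i) < inverse (real (Suc n))"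
    using assms qnorm_less[of x] by simp
  then obtain s where s: "\<And>n. s n \<in> I" "\<And>n. anorm A (aadd A x (s n)) < inverse (real (Suc n))"
    by metis
  let ?t = "\<lambda>n. ascale A (-1) (s n)"
  have sA: "s n \<in> acarrier A" for n using s(1) ideal_facts by blast
  have "anorm A (adiff A (?t n) x) = anorm A (aadd A x (s n))" for n
  proof -
    have "adiff A (?t n) x = ascale A (-1) (aadd A x (s n))"
      using x sA by (simp add: adiff_def scale_add_right add_commute closed)
    then show ?thesis using x sA by (simp add: norm_neg closed)
  qed
  then have "tends_to A ?t x"
    using sA x s(2) by (intro tends_toI[OF _ _ _ LIMSEQ_inverse_real_of_nat])
      (simp_all add: closed less_imp_le del: of_nat_Suc)
  then show ?thesis
    by (rule closedin_tends_toD[OF closed_ideal ideal_facts(4)[OF s(1)]])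
qed

lemma normed_algebra_quot: "normed_algebra (quot_alg A I)"
proof (rule normed_algebra_surjective_image[where \<phi> = "quot_map A I"])
  let ?D = "A\<lparr>anorm := qnorm\<rparr>"
  show "seminormed_algebra ?D"
  proof
    show "aadd ?D x y = aadd ?D y x" if "x \<in> acarrier ?D" "y \<in> acarrier ?D" for x y
      using that add_commute by simp
  qed (simp_all add: closed add_assoc mult_assoc add_zero add_neg
      scale_add_right scale_add_left scale_scale scale_one mult_add_left mult_add_right
      mult_scale_left mult_scale_right qnorm_triangle qnorm_scale qnorm_mult)
  show "quot_map A I x = quot_map A I (azero ?D)" if "x \<in> acarrier ?D" "anorm ?D x = 0" for x
    using that qnorm_eq_zero_imp by (simp add: quot_map_eq_iff zero_closed diff_zero)
  show "azero (quot_alg A I) = quot_map A I (azero ?D)"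
    by (simp add: quot_alg_def)
qed (simp_all add: quot_carrier quot_map_add quot_map_mult quot_map_scale qnorm_quot_map)

sublocale quot: normed_algebra "quot_alg A I"
  by (rule normed_algebra_quot)

lemma quot_dist:
  assumes "x \<in> acarrier A" "y \<in> acarrier A"
  shows "anorm (quot_alg A I) (adiff (quot_alg A I) (quot_map A I x) (quot_map A I y))
    = qnorm (adiff A x y)"
  using assms
  by (simp add: qnorm_quot_map closed
      flip: alg_hom_diff[OF normed_algebra_axioms alg_hom_quot_map])

lemma tends_to_quot_map:
  assumes "tends_to A s x"
  shows "tends_to (quot_alg A I) (\<lambda>n. quot_map A I (s n)) (quot_map A I x)"
  using assms
  by (intro quot.tends_toI[OF _ _ _ tends_toD(3)[OF assms]])
    (simp_all add: tends_toD quot_carrier quot_dist qnorm_le_norm closed)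

text \<open>
  Along a subsequence whose steps have norm less than \<open>2\<^sup>-\<^sup>k\<close>, the cosets have representatives whose
  steps are as small, because the quotient norm is an infimum over representatives.  These converge
  in \<open>A\<close>.
\<close>

lemma quot_alg_BA:
  assumes "A \<in> BA" shows "quot_alg A I \<in> BA"
proof -
  have "\<exists>y. tends_to (quot_alg A I) s y" if s: "is_cauchy (quot_alg A I) s" for s
  proof -
    have "\<forall>n. \<exists>x. x \<in> acarrier A \<and> s n = quot_map A I x"
      using is_cauchy_closed[OF s] by (auto simp: quot_carrier)
    then obtain z where z: "\<And>n. z n \<in> acarrier A" "\<And>n. s n = quot_map A I (z n)"
      by metis
    have "\<forall>k. \<exists>N. \<forall>m\<ge>N. \<forall>n\<ge>N. qnorm (adiff A (z m) (z n)) < (1/2)^k"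
      using s z by (auto simp: is_cauchy_def quot_dist)
    then obtain r where r: "\<And>k m n. \<lbrakk>m \<ge> r k; n \<ge> r k\<rbrakk> \<Longrightarrow> qnorm (adiff A (z m) (z n)) < (1/2)^k"
      by metis
    define R where "R k = k + (\<Sum>i\<le>k. r i)" for k
    have R: "R k \<ge> k" "R k \<ge> r k" "R (Suc k) \<ge> r k" for k
    proof -
      have "r k \<le> (\<Sum>i\<le>k. r i)" by (intro member_le_sum) auto
      then show "R k \<ge> k" "R k \<ge> r k" "R (Suc k) \<ge> r k" by (simp_all add: R_def)
    qed
    have "\<exists>x. \<forall>k. (x k \<in> acarrier A \<and> adiff A (x k) (z (R k)) \<in> I) \<and>
        anorm A (adiff A (x (Suc k)) (x k)) < (1/2)^k"
    proof (rule dependent_nat_choice)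
      show "\<exists>x. x \<in> acarrier A \<and> adiff A x (z (R 0)) \<in> I"
        using z(1)[of "R 0"] ideal_facts(2) by (metis diff_self)
      fix x k assume x: "x \<in> acarrier A \<and> adiff A x (z (R k)) \<in> I"
      let ?w = "z (R (Suc k))"
      have "qnorm (adiff A ?w x) = qnorm (adiff A ?w (z (R k)))"
      proof -
        have "adiff A ?w (z (R k)) = aadd A (adiff A ?w x) (adiff A x (z (R k)))"
          using x z(1) by (simp add: diff_trans)
        then show ?thesis using x z(1) by (simp add: qnorm_add_ideal closed)
      qed
      also have "\<dots> < (1/2)^k" using r R by blast
      finally obtain i where i: "i \<in> I" "anorm A (aadd A (adiff A ?w x) i) < (1/2)^k"
        using qnorm_less by blast
      note iA = ideal_facts(8)[OF i(1)]
      have "adiff A (aadd A ?w i) ?w = i"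
        using add_diff_add[of ?w ?w i "azero A"] z(1) iA
        by (simp add: closed add_zero diff_self diff_zero zero_add)
      moreover have "adiff A (aadd A ?w i) x = aadd A (adiff A ?w x) i"
        using add_diff_add[of ?w x i "azero A"] z(1) iA x by (simp add: closed add_zero diff_zero)
      ultimately show "\<exists>y. (y \<in> acarrier A \<and> adiff A y ?w \<in> I) \<and> anorm A (adiff A y x) < (1/2)^k"
        using i iA z(1) by (intro exI[of _ "aadd A ?w i"]) (simp add: closed)
    qed
    then obtain x where x: "\<And>k. x k \<in> acarrier A" "\<And>k. adiff A (x k) (z (R k)) \<in> I"
      "\<And>k. anorm A (adiff A (x (Suc k)) (x k)) < (1/2)^k" by blast
    have step: "anorm A (adiff A (x (m + d)) (x m)) \<le> 2 * (1/2)^m - 2 * (1/2)^(m + d)" for m d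
    proof (induction d)
      case 0
      then show ?case using x(1) by (simp add: diff_self norm_zero)
    next
      case (Suc d)
      then show ?case
        using dist_triangle[of "x (Suc (m + d))" "x (m + d)" "x m"] x(1) x(3)[of "m + d"] by simp
    qed
    have bound: "anorm A (adiff A (x n) (x m)) \<le> 2 * (1/2)^N" if "m \<ge> N" "n \<ge> m" for m n N
    proof -
      have "anorm A (adiff A (x n) (x m)) \<le> 2 * (1/2)^m - 2 * (1/2)^n"
        using step[of m "n - m"] that by simp
      also have "\<dots> \<le> 2 * (1/2)^m" by simp
      also have "\<dots> \<le> 2 * (1/2)^N"
        using power_decreasing[OF that(1), of "1/2::real"] by simp
      finally show ?thesis .
    qed
    have "is_cauchy A x"
    proof (rule is_cauchyI)
      fix e :: real assume "e > 0"
      then obtain N where N: "(1/2::real)^N < e / 2"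
        using real_arch_pow_inv[of "e / 2" "1/2"] by auto
      have "anorm A (adiff A (x m) (x n)) < e" if "m \<ge> N" "n \<ge> N" for m n
        using bound[of N m n] bound[of N n m] that N dist_commute[OF x(1) x(1), of m n]
        by (cases "m \<le> n") auto
      then show "\<exists>N. \<forall>m\<ge>N. \<forall>n\<ge>N. anorm A (adiff A (x m) (x n)) < e" by blast
    qed (rule x)
    then obtain a where "tends_to A x a" using assms unfolding BA_iff by blast
    then have "tends_to (quot_alg A I) (\<lambda>k. quot_map A I (x k)) (quot_map A I a)"
      by (rule tends_to_quot_map)
    moreover have "quot_map A I (x k) = s (R k)" for k
      using x z by (simp add: quot_map_eq_iff)
    ultimately have sub: "tends_to (quot_alg A I) (\<lambda>k. s (R k)) (quot_map A I a)" by simp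
    have sc: "s n \<in> acarrier (quot_alg A I)" for n using s by (rule is_cauchy_closed)
    have "(\<lambda>n. anorm (quot_alg A I) (adiff (quot_alg A I) (s n) (s (R n)))) \<longlonglongrightarrow> 0"
    proof (rule LIMSEQ_I)
      fix e :: real assume "e > 0"
      then obtain N
        where "\<And>m n. \<lbrakk>m \<ge> N; n \<ge> N\<rbrakk> \<Longrightarrow> anorm (quot_alg A I) (adiff (quot_alg A I) (s m) (s n)) < e"
        using s unfolding is_cauchy_def by meson
      then show "\<exists>N. \<forall>n\<ge>N. norm (anorm (quot_alg A I) (adiff (quot_alg A I) (s n) (s (R n))) - 0) < e"
        using R(1) sc by (intro exI[of _ N]) (auto simp: quot.norm_nonneg quot.closed intro: le_trans)
    qed
    then have "tends_to (quot_alg A I) s (quot_map A I a)"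
      by (intro quot.tends_to_perturb[OF sub sc order_refl])
    then show ?thesis ..
  qed
  then show ?thesis
    unfolding BA_iff using normed_algebra_quot by blast
qed

end

lemma normed_algebra_closed_idealI:
  "normed_algebra A \<Longrightarrow> closed_ideal A I \<Longrightarrow> normed_algebra_closed_ideal A I"
  by (simp add: normed_algebra_closed_ideal_def normed_algebra_ideal_def closed_ideal_def
      normed_algebra_ideal_axioms_def normed_algebra_closed_ideal_axioms_def)

text \<open>
  A homomorphism \<open>f\<close> with \<open>\<bar>f x\<bar> = dist x I\<close> vanishes on \<open>I\<close>, so it has the same value on
  \<open>x\<close> and on the chosen representative of \<open>x + I\<close>; on representatives it is an isometry.
\<close>

lemma topological_iso_quot_alg:
  assumes "normed_algebra A" "closed_ideal A I" "normed_algebra B" "alg_hom A B f"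
    and surj: "f ` acarrier A = acarrier B"
    and norm: "\<And>x. x \<in> acarrier A \<Longrightarrow> anorm B (f x) = anorm (quot_alg A I) x"
  shows "topological_iso (quot_alg A I) B f"
proof -
  interpret A: normed_algebra_closed_ideal A I
    using assms by (intro normed_algebra_closed_idealI)
  interpret B: normed_algebra B by fact
  note hom = alg_homD[OF assms(4)]
  have rep: "f (quot_map A I x) = f x" if x: "x \<in> acarrier A" for x
  proof -
    have "anorm B (f (adiff A (quot_map A I x) x)) = 0"
      using x by (simp add: norm A.closed A.quot_map_closed A.qnorm_ideal A.quot_map_diff)
    then show ?thesis
      using x hom(1) by (simp add: alg_hom_diff[OF assms(1,4)] A.quot_map_closed B.norm_eq_zero
          B.closed B.diff_eq_zero_iff)
  qed
  show ?thesis
  proof (rule topological_iso_isometry[OF A.normed_algebra_quot assms(3)])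
    show "alg_hom (quot_alg A I) B f"
      unfolding alg_hom_def A.quot_carrier
      by (auto simp: A.quot_map_add A.quot_map_mult A.quot_map_scale rep A.closed hom)
    show "f ` acarrier (quot_alg A I) = acarrier B"
      unfolding A.quot_carrier by (simp add: image_image rep surj)
    show "anorm B (f x) = anorm (quot_alg A I) x" if "x \<in> acarrier (quot_alg A I)" for x
      using that norm A.quot_map_closed by (auto simp: A.quot_carrier)
  qed
qed

text \<open>
  Both norms are infima, of \<open>\<bar>j (x + i)\<bar>\<close> over \<open>i \<in> I\<close> and of \<open>\<bar>j x + k\<bar>\<close> over \<open>k\<close> in the closure
  of \<open>j I\<close>.  Replacing an index set by a dense subset does not change an infimum of distances, so the
  bounds for \<open>j\<close> pass to the quotients.
\<close>

lemma dense_embedding_quot: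
  assumes "normed_algebra A" "dense_embedding A C j" "closed_ideal A I"
  defines "K \<equiv> atopology C closure_of (j ` I)"
  shows "dense_embedding (quot_alg A I) (quot_alg C K) (\<lambda>x. quot_map C K (j x))"
    and "\<And>x. x \<in> acarrier A \<Longrightarrow> quot_map C K (j (quot_map A I x)) = quot_map C K (j x)"
proof -
  obtain c M where CB: "C \<in> BA" and C: "normed_algebra C" and hom: "alg_hom A C j"
    and c: "c > 0" "\<And>x. x \<in> acarrier A \<Longrightarrow> c * anorm A x \<le> anorm C (j x)"
    and M: "M > 0" "\<And>x. x \<in> acarrier A \<Longrightarrow> anorm C (j x) \<le> M * anorm A x"
    and dense: "\<And>y. y \<in> acarrier C \<Longrightarrow> \<exists>s. (\<forall>n. s n \<in> acarrier A) \<and> tends_to C (\<lambda>n. j (s n)) y"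
    using assms(2) by (rule dense_embeddingE) blast
  interpret A: normed_algebra_closed_ideal A I
    using assms by (intro normed_algebra_closed_idealI)
  have K: "closed_ideal C K"
    unfolding K_def using assms(2) A.ideal assms(1) by (rule closed_ideal_closure_image)
  interpret C: normed_algebra_closed_ideal C K
    using C K by (rule normed_algebra_closed_idealI)
  note jA = alg_homD[OF hom]
  have sub: "j ` I \<subseteq> acarrier C"
    using A.ideal_facts(8) jA(1) by blast
  have jI: "j i \<in> K" if "i \<in> I" for i
    using closure_of_subset[of "j ` I" "atopology C"] sub that
    by (auto simp: K_def C.topspace_atopology)
  show rep: "quot_map C K (j (quot_map A I x)) = quot_map C K (j x)" if x: "x \<in> acarrier A" for x
    using x jA(1) jI[OF A.quot_map_diff[OF x]]
    by (simp add: C.quot_map_eq_iff A.quot_map_closed alg_hom_diff[OF assms(1) hom])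
  let ?h = "\<lambda>x. quot_map C K (j x)"
  have upper: "C.qnorm (j x) \<le> M * A.qnorm x" if x: "x \<in> acarrier A" for x
  proof -
    have "C.qnorm (j x) / M \<le> anorm A (aadd A x i)" if i: "i \<in> I" for i
    proof -
      have "C.qnorm (j x) \<le> anorm C (aadd C (j x) (j i))"
        using x i jA(1) jI by (intro C.qnorm_le)
      also have "\<dots> \<le> M * anorm A (aadd A x i)"
        using M(2)[of "aadd A x i"] x A.ideal_facts(8)[OF i] by (simp add: jA A.closed)
      finally show ?thesis using M(1) by (simp add: divide_le_eq mult.commute)
    qed
    then have "C.qnorm (j x) / M \<le> A.qnorm x" by (rule A.qnorm_greatest)
    then show ?thesis using M(1) by (simp add: divide_le_eq mult.commute)
  qed
  have lower: "c * A.qnorm x \<le> C.qnorm (j x)" if x: "x \<in> acarrier A" for x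
  proof (rule C.qnorm_greatest)
    fix k assume k: "k \<in> K"
    show "c * A.qnorm x \<le> anorm C (aadd C (j x) k)"
    proof (rule field_le_epsilon)
      fix e :: real assume "e > 0"
      then obtain i where i: "i \<in> I" "anorm C (adiff C (j i) k) < e"
        using k unfolding K_def C.closure_of_iff[OF sub] by blast
      note iA = A.ideal_facts(8)[OF i(1)] and kC = C.ideal_facts(8)[OF k]
      have "c * A.qnorm x \<le> c * anorm A (aadd A x i)"
        using c(1) x i by (intro mult_left_mono A.qnorm_le) auto
      also have "\<dots> \<le> anorm C (aadd C (j x) (j i))"
        using c(2)[of "aadd A x i"] x iA by (simp add: jA A.closed)
      also have "\<dots> \<le> anorm C (aadd C (j x) k) + anorm C (adiff C (j i) k)"
      proof -
        have "aadd C (j x) (j i) = aadd C (aadd C (j x) k) (adiff C (j i) k)"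
          using x iA kC jA(1) by (simp add: C.add_assoc C.closed C.add_diff_cancel)
        then show ?thesis
          using x iA kC jA(1) by (simp add: C.norm_triangle C.closed)
      qed
      finally show "c * A.qnorm x \<le> anorm C (aadd C (j x) k) + e" using i(2) by simp
    qed
  qed
  have hom': "alg_hom (quot_alg A I) (quot_alg C K) ?h"
    unfolding alg_hom_def A.quot_carrier C.quot_carrier
    using jA(1)
    by (auto simp: A.quot_map_add A.quot_map_mult A.quot_map_scale C.quot_map_add C.quot_map_mult
        C.quot_map_scale rep A.closed jA(2-4) A.quot_map_closed)
  have bounds: "c * A.qnorm x \<le> anorm (quot_alg C K) (?h x)" "anorm (quot_alg C K) (?h x) \<le> M * A.qnorm x"
    if "x \<in> acarrier (quot_alg A I)" for x
    using that upper lower jA(1) A.quot_map_closed by (auto simp: A.quot_carrier C.qnorm_quot_map)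
  have sub': "?h ` acarrier (quot_alg A I) \<subseteq> acarrier (quot_alg C K)"
    using alg_homD(1)[OF hom'] by blast
  have "y \<in> atopology (quot_alg C K) closure_of (?h ` acarrier (quot_alg A I))"
    if y: "y \<in> acarrier (quot_alg C K)" for y
  proof -
    obtain x where x: "x \<in> acarrier C" "y = quot_map C K x"
      using y by (auto simp: C.quot_carrier)
    obtain s where s: "\<forall>n. s n \<in> acarrier A" "tends_to C (\<lambda>n. j (s n)) x"
      using dense[OF x(1)] by blast
    have "tends_to (quot_alg C K) (\<lambda>n. ?h (s n)) y"
      unfolding x(2) by (rule C.tends_to_quot_map[OF s(2)])
    moreover have "?h (s n) \<in> ?h ` acarrier (quot_alg A I)" for n
      using s(1) by (auto simp: A.quot_carrier image_image rep)
    ultimately show ?thesis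
      unfolding C.quot.closure_of_iff_tends_to[OF sub']
      by (intro exI[of _ "\<lambda>n. ?h (s n)"]) blast
  qed
  then have "atopology (quot_alg C K) closure_of (?h ` acarrier (quot_alg A I)) = acarrier (quot_alg C K)"
    using C.quot.closure_of_iff[OF sub'] by blast
  then show "dense_embedding (quot_alg A I) (quot_alg C K) ?h"
    unfolding dense_embedding_def
    using hom' C.quot_alg_BA[OF CB] c(1) M(1) bounds by blast
qed

text \<open>
  \<open>L / K\<close> is closed because it is the kernel of the bounded map \<open>A / K \<rightarrow> A / L\<close>.  This map induces an
  isometry because, as \<open>K \<subseteq> L\<close>, taking infima over \<open>K\<close> and then over \<open>L\<close> is taking them over \<open>L\<close>.
\<close>

lemma topological_iso_quot_quot:
  assumes "normed_algebra A" "closed_ideal A K" "closed_ideal A L" "K \<subseteq> L"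
  shows "closed_ideal (quot_alg A K) (quot_map A K ` L)"
    and "topological_iso (quot_alg (quot_alg A K) (quot_map A K ` L)) (quot_alg A L) (quot_map A L)"
proof -
  interpret K: normed_algebra_closed_ideal A K
    using assms by (intro normed_algebra_closed_idealI)
  interpret L: normed_algebra_closed_ideal A L
    using assms by (intro normed_algebra_closed_idealI)
  have rep: "quot_map A L (quot_map A K x) = quot_map A L x" if x: "x \<in> acarrier A" for x
    using x K.quot_map_diff[OF x] assms(4) by (auto simp: L.quot_map_eq_iff K.quot_map_closed)
  have hom: "alg_hom (quot_alg A K) (quot_alg A L) (quot_map A L)"
    unfolding alg_hom_def K.quot_carrier L.quot_carrier
    by (auto simp: K.quot_map_add K.quot_map_mult K.quot_map_scale L.quot_map_add L.quot_map_mult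
        L.quot_map_scale rep K.closed K.quot_map_closed)
  have norm_le: "L.qnorm x \<le> K.qnorm x" if x: "x \<in> acarrier A" for x
    using assms(4) x L.qnorm_le by (intro K.qnorm_greatest) auto
  have bound: "anorm (quot_alg A L) (quot_map A L x) \<le> 1 * anorm (quot_alg A K) x"
    if "x \<in> acarrier (quot_alg A K)" for x
    using that norm_le K.quot_map_closed by (auto simp: K.quot_carrier L.qnorm_quot_map)
  have "closed_ideal (quot_alg A L) {azero (quot_alg A L)}"
  proof -
    have "azero (quot_alg A L) = x" if "tends_to (quot_alg A L) s x" "\<And>n. s n = azero (quot_alg A L)" for s x
      using L.quot.tends_to_unique[OF L.quot.tends_to_const[OF L.quot.zero_closed]] that
      by (metis ext)
    then have "closedin (atopology (quot_alg A L)) {azero (quot_alg A L)}"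
      unfolding L.quot.closedin_iff_tends_to by (auto simp: L.quot.closed image_subset_iff)
    moreover have "amult (quot_alg A L) a (azero (quot_alg A L)) = azero (quot_alg A L)"
        "amult (quot_alg A L) (azero (quot_alg A L)) a = azero (quot_alg A L)"
      if "a \<in> acarrier (quot_alg A L)" for a
      using that L.quot.mult_scale_right[of a "azero (quot_alg A L)" 0]
        L.quot.mult_scale_left[of "azero (quot_alg A L)" a 0]
      by (simp_all add: L.quot.scale_zero_left L.quot.closed)
    ultimately show ?thesis
      unfolding closed_ideal_def alg_ideal_def
      by (simp add: L.quot.closed L.quot.add_zero L.quot.scale_zero_right)
  qed
  then have "closed_ideal (quot_alg A K)
      {x \<in> acarrier (quot_alg A K). quot_map A L x \<in> {azero (quot_alg A L)}}"
    by (rule closed_ideal_vimage[OF K.normed_algebra_quot L.normed_algebra_quot hom _ bound])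
  also have "{x \<in> acarrier (quot_alg A K). quot_map A L x \<in> {azero (quot_alg A L)}} = quot_map A K ` L"
    using L.ideal_facts(8) by (auto simp: K.quot_carrier rep L.quot_map_eq_zero_iff)
  finally show LK: "closed_ideal (quot_alg A K) (quot_map A K ` L)" .
  interpret Q: normed_algebra_closed_ideal "quot_alg A K" "quot_map A K ` L"
    using K.normed_algebra_quot LK by (rule normed_algebra_closed_idealI)
  show "topological_iso (quot_alg (quot_alg A K) (quot_map A K ` L)) (quot_alg A L) (quot_map A L)"
  proof (rule topological_iso_quot_alg[OF K.normed_algebra_quot LK L.normed_algebra_quot hom])
    show "quot_map A L ` acarrier (quot_alg A K) = acarrier (quot_alg A L)"
      by (simp add: K.quot_carrier L.quot_carrier image_image rep)
    fix y assume "y \<in> acarrier (quot_alg A K)"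
    then obtain x where x: "x \<in> acarrier A" "y = quot_map A K x"
      by (auto simp: K.quot_carrier)
    have sum: "anorm (quot_alg A K) (aadd (quot_alg A K) y (quot_map A K l)) = K.qnorm (aadd A x l)"
      if "l \<in> L" for l
      using x L.ideal_facts(8)[OF that] by (simp add: K.quot_map_add K.qnorm_quot_map K.closed)
    have "L.qnorm x \<le> Q.qnorm y"
    proof (rule Q.qnorm_greatest)
      fix k assume "k \<in> quot_map A K ` L"
      then obtain l where l: "l \<in> L" "k = quot_map A K l" by blast
      have "L.qnorm x = L.qnorm (aadd A x l)" using x(1) l(1) by (simp add: L.qnorm_add_ideal)
      also have "\<dots> \<le> K.qnorm (aadd A x l)"
        using x(1) L.ideal_facts(8)[OF l(1)] by (intro norm_le K.closed)
      finally show "L.qnorm x \<le> anorm (quot_alg A K) (aadd (quot_alg A K) y k)"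
        using l sum by simp
    qed
    moreover have "Q.qnorm y \<le> L.qnorm x"
    proof (rule L.qnorm_greatest)
      fix l assume l: "l \<in> L"
      have "Q.qnorm y \<le> anorm (quot_alg A K) (aadd (quot_alg A K) y (quot_map A K l))"
        using x l by (intro Q.qnorm_le) (auto simp: K.quot_carrier)
      also have "\<dots> \<le> anorm A (aadd A x l)"
        unfolding sum[OF l] using x(1) L.ideal_facts(8)[OF l] by (intro K.qnorm_le_norm K.closed)
      finally show "Q.qnorm y \<le> anorm A (aadd A x l)" .
    qed
    ultimately show "anorm (quot_alg A L) (quot_map A L y) = Q.qnorm y"
      using x by (simp add: rep L.qnorm_quot_map)
  qed
qed

section \<open>Radicals and completions\<close>

lemma is_completion_completion:
  fixes A :: "'a::sequence_closed nalg"
  assumes "normed_algebra A"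
  shows "is_completion A (completion A) (completion_map A)"
proof -
  have "\<exists>p. is_completion A (fst p) (snd p)"
    using ex_completion[OF assms] by simp
  then show ?thesis
    unfolding completion_def completion_map_def completion_pair_def by (rule someI_ex)
qed

lemma dense_embedding_completion:
  fixes A :: "'a::sequence_closed nalg"
  assumes "normed_algebra A"
  shows "dense_embedding A (completion A) (completion_map A)"
  using is_completion_completion[OF assms]
  unfolding dense_embedding_def is_completion_def by (auto intro!: exI[of _ 1])

lemma dense_embedding_iso_compose:
  assumes "normed_algebra A" "normed_algebra B" "topological_iso A B f" "dense_embedding B C j"
  shows "dense_embedding A C (\<lambda>x. j (f x))"
proof -
  obtain c M where f: "alg_hom A B f" "bij_betw f (acarrier A) (acarrier B)" "c > 0" "M > 0"
    "\<And>x. x \<in> acarrier A \<Longrightarrow> c * anorm A x \<le> anorm B (f x)"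
    "\<And>x. x \<in> acarrier A \<Longrightarrow> anorm B (f x) \<le> M * anorm A x"
    using assms(3) unfolding topological_iso_iff[OF assms(1,2)] by blast
  obtain c' M' where j: "C \<in> BA" "alg_hom B C j" "c' > 0" "M' > 0"
    "\<And>x. x \<in> acarrier B \<Longrightarrow> c' * anorm B x \<le> anorm C (j x)"
    "\<And>x. x \<in> acarrier B \<Longrightarrow> anorm C (j x) \<le> M' * anorm B x"
    using assms(4) by (rule dense_embeddingE) blast
  have "(c' * c) * anorm A x \<le> anorm C (j (f x))" "anorm C (j (f x)) \<le> (M' * M) * anorm A x"
    if x: "x \<in> acarrier A" for x
  proof -
    have fx: "f x \<in> acarrier B" using f(1) x by (rule alg_homD)
    show "(c' * c) * anorm A x \<le> anorm C (j (f x))"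
      using order_trans[OF mult_left_mono[OF f(5)[OF x]] j(5)[OF fx]] j(3) by (simp add: mult.assoc)
    show "anorm C (j (f x)) \<le> (M' * M) * anorm A x"
      using order_trans[OF j(6)[OF fx] mult_left_mono[OF f(6)[OF x]]] j(4) by (simp add: mult.assoc)
  qed
  moreover have "(\<lambda>x. j (f x)) ` acarrier A = j ` acarrier B"
    using f(2) by (simp add: bij_betw_def image_image[of j f, symmetric])
  moreover have "c' * c > 0" "M' * M > 0" using f j by simp_all
  ultimately show ?thesis
    using j(1) alg_hom_compose[OF f(1) j(2)] assms(4) unfolding dense_embedding_def by metis
qed

text \<open>
  The radical \<^term>\<open>completion_rad R A\<close> may be computed in any Banach algebra that contains \<open>A\<close> densely,
  because \<open>R\<close> commutes with the isomorphism between this algebra and the completion.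
\<close>

lemma completion_rad_eq:
  fixes A :: "'a::sequence_closed nalg"
  assumes "iso_invariant_rad \<A> R" "closed_ideal_map \<A> R" "BA \<subseteq> \<A>"
    and A: "normed_algebra A" and j: "dense_embedding A C j"
  shows "completion_rad R A = {x \<in> acarrier A. j x \<in> R C}"
proof -
  let ?B = "completion A" and ?\<iota> = "completion_map A"
  have \<iota>: "dense_embedding A ?B ?\<iota>" using A by (rule dense_embedding_completion)
  then obtain g where g: "topological_iso ?B C g" "\<And>x. x \<in> acarrier A \<Longrightarrow> g (?\<iota> x) = j x"
    using dense_embedding_unique[OF A \<iota> j] by blast
  have BA: "?B \<in> BA" "C \<in> BA" and hom: "alg_hom A ?B ?\<iota>"
    using \<iota> j by (auto simp: dense_embedding_def)
  have img: "g ` R ?B = R C"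
    using assms(1,3) BA g(1) unfolding iso_invariant_rad_def by blast
  have "R ?B \<subseteq> acarrier ?B"
    using assms(2,3) BA(1) unfolding closed_ideal_map_def closed_ideal_def alg_ideal_def by blast
  moreover have "inj_on g (acarrier ?B)"
    using g(1) by (auto simp: topological_iso_def bij_betw_def)
  ultimately have "g (?\<iota> x) \<in> R C \<longleftrightarrow> ?\<iota> x \<in> R ?B" if "x \<in> acarrier A" for x
    unfolding img[symmetric] using alg_homD(1)[OF hom that] by (intro inj_on_image_mem_iff)
  then show ?thesis
    unfolding completion_rad_def using g(2) by auto
qed

text \<open>
  If \<open>K \<subseteq> R C\<close>, then \<open>R (C / K)\<close> goes to \<open>R (C / R C) = 0\<close> under \<open>C / K \<rightarrow> C / R C\<close>.
\<close>

lemma quot_map_mem_rad_imp: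
  assumes "closed_ideal_map \<A> R" "zero_on_quot_rad \<A> R" "iso_invariant_rad \<A> R" "quot_map_rad \<A> R"
    and "BA \<subseteq> \<A>" and C: "C \<in> BA" and K: "closed_ideal C K" "K \<subseteq> R C"
    and x: "x \<in> acarrier C" "quot_map C K x \<in> R (quot_alg C K)"
  shows "x \<in> R C"
proof -
  let ?L = "R C" and ?Q = "quot_alg C K"
  let ?LK = "quot_map C K ` ?L"
  have N: "normed_algebra C" using C by (simp add: BA_def)
  have L: "closed_ideal C ?L"
    using assms(1,5) C unfolding closed_ideal_map_def by blast
  interpret K: normed_algebra_closed_ideal C K
    using N K(1) by (rule normed_algebra_closed_idealI)
  interpret L: normed_algebra_closed_ideal C ?L
    using N L by (rule normed_algebra_closed_idealI)
  note iso = topological_iso_quot_quot[OF N K(1) L K(2)]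
  interpret Q: normed_algebra_closed_ideal ?Q ?LK
    using K.normed_algebra_quot iso(1) by (rule normed_algebra_closed_idealI)
  let ?f = "quot_map C ?L"
  have QB: "?Q \<in> BA" using C by (rule K.quot_alg_BA)
  have "quot_map ?Q ?LK (quot_map C K x) \<in> R (quot_alg ?Q ?LK)"
    using assms(4,5) QB iso(1) x(2) unfolding quot_map_rad_def by blast
  moreover have "?f ` R (quot_alg ?Q ?LK) = R (quot_alg C ?L)"
    using assms(3,5) Q.quot_alg_BA[OF QB] L.quot_alg_BA[OF C] iso(2)
    unfolding iso_invariant_rad_def by blast
  ultimately have "?f (quot_map ?Q ?LK (quot_map C K x)) \<in> R (quot_alg C ?L)" by blast
  moreover have "R (quot_alg C ?L) = {azero (quot_alg C ?L)}"
    using assms(2,5) C unfolding zero_on_quot_rad_def by blast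
  moreover have "?f (quot_map ?Q ?LK (quot_map C K x)) = ?f x"
  proof -
    \<comment> \<open>The representative of the coset of a coset need not be congruent to \<open>x\<close> modulo \<open>K\<close>, but it is
      congruent to \<open>x\<close> modulo \<open>R C\<close>.\<close>
    obtain l where l: "l \<in> ?L"
      "quot_map ?Q ?LK (quot_map C K x) = aadd ?Q (quot_map C K x) (quot_map C K l)"
      using Q.quot_map_in_coset by blast
    note lC = L.ideal_facts(8)[OF l(1)]
    let ?y = "quot_map C K (aadd C x l)"
    have "aadd C (adiff C ?y (aadd C x l)) l \<in> ?L"
      using K.quot_map_diff[of "aadd C x l"] x(1) l(1) lC K(2) by (auto simp: K.closed intro: L.ideal_facts)
    moreover have "aadd C (adiff C ?y (aadd C x l)) l = adiff C ?y x"
    proof -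
      have "adiff C (aadd C x l) x = l"
        using K.add_diff_add[of x x l "azero C"] x(1) lC
        by (simp add: K.closed K.add_zero K.diff_self K.diff_zero K.zero_add)
      then show ?thesis
        using K.diff_trans[of ?y "aadd C x l" x] x(1) lC by (simp add: K.closed K.quot_map_closed)
    qed
    ultimately show ?thesis
      using x(1) lC by (simp add: l(2) K.quot_map_add L.quot_map_eq_iff K.closed K.quot_map_closed)
  qed
  ultimately show ?thesis
    using x(1) L.quot_map_eq_zero_iff by simp
qed

context
  fixes \<A> :: "'a::sequence_closed nalg set" and R :: "'a nalg \<Rightarrow> 'a set"
  assumes BA: "BA \<subseteq> \<A>" and TR: "TR \<A> R"
begin

lemma rad:
  "closed_ideal_map \<A> R" "zero_on_quot_rad \<A> R" "iso_invariant_rad \<A> R" "quot_map_rad \<A> R"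
  "ideal_rad \<A> R"
  using TR by (simp_all add: TR_def)

lemmas rad_eq = completion_rad_eq[OF rad(3) rad(1) BA]

lemma closed_ideal_completion_rad:
  assumes "normed_algebra A" shows "closed_ideal A (completion_rad R A)"
proof -
  obtain M where C: "completion A \<in> BA" "normed_algebra (completion A)"
    and hom: "alg_hom A (completion A) (completion_map A)"
    and M: "\<And>x. x \<in> acarrier A \<Longrightarrow> anorm (completion A) (completion_map A x) \<le> M * anorm A x"
    using dense_embedding_completion[OF assms] by (rule dense_embeddingE) blast
  have "closed_ideal (completion A) (R (completion A))"
    using rad(1) BA C(1) unfolding closed_ideal_map_def by blast
  then show ?thesis
    unfolding completion_rad_def using M by (rule closed_ideal_vimage[OF assms C(2) hom])
qed

text \<open>
  The completion of \<open>A / J\<close>, where \<open>J = A \<inter> R C\<close>, is \<open>C / K\<close> and need not be \<open>C / R C\<close>: here \<open>K\<close>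
  is the closure of \<open>J\<close>, which may be smaller than \<open>R C\<close>.  So \<open>R (C / R C) = 0\<close> must be transported to \<open>C / K\<close>.
\<close>

lemma zero_on_quot_completion_rad: "zero_on_quot_rad NA (completion_rad R)"
  unfolding zero_on_quot_rad_def
proof
  fix A :: "'a nalg" assume "A \<in> NA"
  then have A: "normed_algebra A" by (simp add: NA_def)
  let ?J = "completion_rad R A" and ?C = "completion A" and ?\<iota> = "completion_map A"
  let ?K = "atopology ?C closure_of (?\<iota> ` ?J)"
  have \<iota>: "dense_embedding A ?C ?\<iota>" using A by (rule dense_embedding_completion)
  then have C: "?C \<in> BA" "normed_algebra ?C" and hom: "alg_hom A ?C ?\<iota>"
    by (auto simp: dense_embedding_def BA_def)
  have J: "closed_ideal A ?J" using A by (rule closed_ideal_completion_rad)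
  interpret J: normed_algebra_closed_ideal A ?J
    using A J by (rule normed_algebra_closed_idealI)
  have K: "closed_ideal ?C ?K"
    using closed_ideal_closure_image[OF \<iota> J.ideal A] .
  have "closedin (atopology ?C) (R ?C)"
    using rad(1) BA C(1) unfolding closed_ideal_map_def closed_ideal_def by blast
  then have KR: "?K \<subseteq> R ?C"
    by (intro closure_of_minimal) (auto simp: completion_rad_def)
  note quot = dense_embedding_quot[OF A \<iota> J]
  have "x = azero (quot_alg A ?J)" if x: "x \<in> completion_rad R (quot_alg A ?J)" for x
  proof -
    have xQ: "x \<in> acarrier (quot_alg A ?J)" "quot_map ?C ?K (?\<iota> x) \<in> R (quot_alg ?C ?K)"
      using x by (simp_all add: rad_eq[OF J.normed_algebra_quot quot(1)])
    then have xA: "x \<in> acarrier A" and q: "quot_map A ?J x = x"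
      using J.quot_map_closed J.quot_map_idem by (auto simp: J.quot_carrier)
    have "?\<iota> x \<in> R ?C"
      using quot_map_mem_rad_imp[OF rad(1-4) BA C(1) K KR alg_homD(1)[OF hom xA] xQ(2)] .
    then have "x \<in> ?J" using xA by (simp add: completion_rad_def)
    then show ?thesis using J.quot_map_eq_zero_iff[OF xA] q by simp
  qed
  moreover have "azero (quot_alg A ?J) \<in> completion_rad R (quot_alg A ?J)"
    using closed_ideal_completion_rad[OF J.normed_algebra_quot]
    by (simp add: closed_ideal_def alg_ideal_def)
  ultimately show "completion_rad R (quot_alg A ?J) = {azero (quot_alg A ?J)}" by blast
qed

lemma iso_invariant_completion_rad: "iso_invariant_rad NA (completion_rad R)"
  unfolding iso_invariant_rad_def
proof (intro ballI allI impI)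
  fix A B :: "'a nalg" and f
  assume "A \<in> NA" "B \<in> NA" and f: "topological_iso A B f"
  then have A: "normed_algebra A" and B: "normed_algebra B" by (simp_all add: NA_def)
  have "completion_rad R A = {x \<in> acarrier A. completion_map B (f x) \<in> R (completion B)}"
    using A dense_embedding_iso_compose[OF A B f dense_embedding_completion[OF B]] by (rule rad_eq)
  moreover have "acarrier B = f ` acarrier A"
    using f by (simp add: topological_iso_def bij_betw_def)
  then have "completion_rad R B = {y \<in> f ` acarrier A. completion_map B y \<in> R (completion B)}"
    by (simp add: completion_rad_def)
  ultimately show "f ` completion_rad R A = completion_rad R B" by auto
qed

lemma quot_map_completion_rad: "quot_map_rad NA (completion_rad R)"
  unfolding quot_map_rad_def
proof (intro ballI allI impI subsetI)
  fix A :: "'a nalg" and I y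
  assume "A \<in> NA" and I: "closed_ideal A I" and y: "y \<in> quot_map A I ` completion_rad R A"
  then have A: "normed_algebra A" by (simp add: NA_def)
  let ?C = "completion A" and ?\<iota> = "completion_map A"
  let ?K = "atopology ?C closure_of (?\<iota> ` I)"
  have \<iota>: "dense_embedding A ?C ?\<iota>" using A by (rule dense_embedding_completion)
  then have C: "?C \<in> BA" by (auto simp: dense_embedding_def)
  interpret I: normed_algebra_closed_ideal A I
    using A I by (rule normed_algebra_closed_idealI)
  have K: "closed_ideal ?C ?K"
    using closed_ideal_closure_image[OF \<iota> I.ideal A] .
  note quot = dense_embedding_quot[OF A \<iota> I]
  obtain x where x: "x \<in> acarrier A" "?\<iota> x \<in> R ?C" "y = quot_map A I x"
    using y by (auto simp: completion_rad_def)
  have "quot_map ?C ?K (?\<iota> x) \<in> R (quot_alg ?C ?K)"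
    using rad(4) BA C K x(2) unfolding quot_map_rad_def by blast
  then show "y \<in> completion_rad R (quot_alg A I)"
    unfolding rad_eq[OF I.normed_algebra_quot quot(1)] using x by (simp add: quot(2) I.quot_carrier)
qed

text \<open>
  The closure \<open>K\<close> of \<open>I\<close> in the completion of \<open>A\<close> is a completion of \<open>I\<close>, so the conditions on
  ideals of normed algebras reduce to those on the closed ideals \<open>K\<close> of Banach algebras.
\<close>

lemma completion_rad_sub_alg:
  assumes "normed_algebra A" "alg_ideal A I"
  obtains K where "closed_ideal (completion A) K" "sub_alg (completion A) K \<in> BA"
    "completion_map A ` I \<subseteq> K"
    "completion_rad R (sub_alg A I) = {x \<in> I. completion_map A x \<in> R (sub_alg (completion A) K)}"
proof -
  let ?C = "completion A" and ?\<iota> = "completion_map A"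
  let ?K = "atopology ?C closure_of (?\<iota> ` I)"
  have \<iota>: "dense_embedding A ?C ?\<iota>" using assms(1) by (rule dense_embedding_completion)
  have K: "closed_ideal ?C ?K"
    using closed_ideal_closure_image[OF \<iota> assms(2,1)] .
  have emb: "dense_embedding (sub_alg A I) (sub_alg ?C ?K) ?\<iota>"
    using dense_embedding_ideal[OF \<iota> assms(2,1)] .
  show thesis
  proof (rule that[OF K])
    show "sub_alg ?C ?K \<in> BA" using emb by (simp add: dense_embedding_def)
    show "?\<iota> ` I \<subseteq> ?K"
      using emb alg_homD(1)[of "sub_alg A I" "sub_alg ?C ?K" ?\<iota>] by (auto simp: dense_embedding_def)
    show "completion_rad R (sub_alg A I) = {x \<in> I. ?\<iota> x \<in> R (sub_alg ?C ?K)}"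
      using rad_eq[OF normed_algebra_sub_alg[OF assms] emb] by simp
  qed
qed

lemma ideal_rad_completion_rad: "ideal_rad NA (completion_rad R)"
  unfolding ideal_rad_def
proof (intro ballI allI impI; elim conjE)
  fix A :: "'a nalg" and I
  assume "A \<in> NA" and I: "alg_ideal A I"
  then have A: "normed_algebra A" by (simp add: NA_def)
  let ?C = "completion A" and ?\<iota> = "completion_map A"
  have C: "?C \<in> BA" "normed_algebra ?C" and hom: "alg_hom A ?C ?\<iota>"
    using dense_embedding_completion[OF A] by (auto simp: dense_embedding_def BA_def)
  obtain K where K: "closed_ideal ?C K" "sub_alg ?C K \<in> BA" "?\<iota> ` I \<subseteq> K"
    and eq: "completion_rad R (sub_alg A I) = {x \<in> I. ?\<iota> x \<in> R (sub_alg ?C K)}"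
    by (rule completion_rad_sub_alg[OF A I]) (rule that)
  have mem: "?C \<in> \<A>" "alg_ideal ?C K" "sub_alg ?C K \<in> \<A>"
    using BA C(1) K(1,2) by (auto simp: closed_ideal_def)
  have RK: "alg_ideal ?C (R (sub_alg ?C K))" "R (sub_alg ?C K) \<subseteq> R ?C"
    using bspec[OF rad(5)[unfolded ideal_rad_def] mem(1), THEN spec, THEN mp, OF conjI[OF mem(2,3)]]
    by simp_all
  have "alg_ideal A (completion_rad R (sub_alg A I))"
    unfolding eq alg_ideal_def
    by (simp add: subset_iff alg_idealD(2-4,6-8)[OF I] alg_idealD(2-4,6,7)[OF RK(1)] alg_homD[OF hom]
        alg_hom_zero[OF A C(2) hom])
  moreover have "completion_rad R (sub_alg A I) \<subseteq> I \<inter> completion_rad R A"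
    unfolding eq using RK(2) alg_idealD(1)[OF I] by (auto simp: completion_rad_def)
  ultimately show "alg_ideal A (completion_rad R (sub_alg A I)) \<and>
      completion_rad R (sub_alg A I) \<subseteq> I \<inter> completion_rad R A" ..
qed

lemma OTR_completion_rad: "OTR NA (completion_rad R)"
  unfolding OTR_def closed_ideal_map_def
  using closed_ideal_completion_rad zero_on_quot_completion_rad iso_invariant_completion_rad
    quot_map_completion_rad ideal_rad_completion_rad
  by (simp add: NA_def)

lemma hereditary_completion_rad:
  assumes "hereditary_rad \<A> R" shows "hereditary_rad NA (completion_rad R)"
  unfolding hereditary_rad_def
proof (intro ballI allI impI; elim conjE)
  fix A :: "'a nalg" and I
  assume "A \<in> NA" and I: "alg_ideal A I"
  then have A: "normed_algebra A" by (simp add: NA_def)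
  let ?C = "completion A" and ?\<iota> = "completion_map A"
  have C: "?C \<in> BA"
    using dense_embedding_completion[OF A] by (auto simp: dense_embedding_def)
  obtain K where K: "closed_ideal ?C K" "sub_alg ?C K \<in> BA" "?\<iota> ` I \<subseteq> K"
    and eq: "completion_rad R (sub_alg A I) = {x \<in> I. ?\<iota> x \<in> R (sub_alg ?C K)}"
    by (rule completion_rad_sub_alg[OF A I]) (rule that)
  have mem: "?C \<in> \<A>" "alg_ideal ?C K" "sub_alg ?C K \<in> \<A>"
    using BA C K(1,2) by (auto simp: closed_ideal_def)
  have "R (sub_alg ?C K) = K \<inter> R ?C"
    by (rule bspec[OF assms[unfolded hereditary_rad_def] mem(1), THEN spec, THEN mp,
        OF conjI[OF mem(2,3)]])
  then show "completion_rad R (sub_alg A I) = I \<inter> completion_rad R A"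
    using eq K(3) alg_idealD(1)[OF I] by (auto simp: completion_rad_def)
qed

lemma HTR_completion_rad:
  assumes "hereditary_rad \<A> R" shows "HTR NA (completion_rad R)"
proof -
  have her: "hereditary_rad NA (completion_rad R)"
    using assms by (rule hereditary_completion_rad)
  \<comment> \<open>Heredity for the ideal \<open>completion_rad R A\<close> of \<open>A\<close> is idempotence.\<close>
  have "completion_rad R (sub_alg A (completion_rad R A)) = completion_rad R A"
    if "A \<in> NA" for A :: "'a nalg"
  proof -
    have A: "normed_algebra A" using that by (simp add: NA_def)
    have "alg_ideal A (completion_rad R A)"
      using closed_ideal_completion_rad[OF A] by (simp add: closed_ideal_def)
    moreover from this have "sub_alg A (completion_rad R A) \<in> NA"
      using normed_algebra_sub_alg[OF A] by (simp add: NA_def)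
    ultimately show ?thesis
      using her that unfolding hereditary_rad_def by blast
  qed
  then have "idempotent_rad NA (completion_rad R)"
    by (simp add: idempotent_rad_def)
  then show ?thesis
    using OTR_completion_rad her by (simp add: HTR_def TR_def OTR_def)
qed

end

theorem theorem2p21:
  fixes \<A> :: "'a::sequence_closed nalg set" and R :: "'a nalg \<Rightarrow> 'a set"
  assumes "ground_class \<A>" and "BA \<subseteq> \<A>"
  shows "(TR \<A> R \<longrightarrow> OTR NA (completion_rad R)) \<and>
    (HTR \<A> R \<longrightarrow> HTR NA (completion_rad R))"
  using OTR_completion_rad[OF assms(2)] HTR_completion_rad[OF assms(2)] by (simp add: HTR_def)

end
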